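(* Let $X$ be a real random variable with density $f$, finite mean $\mu$, and let $q(x)=\delta x^2+\beta x+\gamma$ (real coefficients) be such that $\int_{-\infty}^x(\mu-t)f(t)\,dt=q(x)f(x)$ for all $x\in\mathbb{R}$. Let $(r,s)=\{x: f(x)>0\}$ and, for an integer $k\ge0$, let $$P_k(x)=\frac{(-1)^k}{f(x)}\frac{d^k}{dx^k}\bigl[q^k(x)f(x)\bigr],\qquad x\in(r,s).$$ (a) If $k\ge1$ and $X$ has $2k-1$ finite moments (i.e. $\mathbb{E}|X|^{2k-1}<\infty$), then for all $x\in(r,s)$ $$q^k(x)f(x)=\frac{(-1)^k}{(k-1)!}\int_r^x(x-y)^{k-1}P_k(y)f(y)\,dy=\frac{1}{(k-1)!}\int_x^s(y-x)^{k-1}P_k(y)f(y)\,dy.$$ (b) If $X$ has $2k$ finite moments (i.e. $\mathbb{E}|X|^{2k}<\infty$) and $g:(r,s)\to\mathbb{R}$ is a function with $k$-th derivative $g^{(k)}$ satisfying $\mathbb{E}\bigl[q^k(X)|g^{(k)}(X)|\bigr]<\infty$, then $\mathbb{E}|P_k(X)g(X)|<\infty$ and $$\mathbb{E}[P_k(X)g(X)]=\mathbb{E}\bigl[q^k(X)g^{(k)}(X)\bigr].$$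
   Context: Here $q^k(x)=(q(x))^k$, and $q$ has degree at most 2 ($\delta,\beta$ may be zero). The displayed identity defining $q$ implies that (after possibly redefining $f$ at finite endpoints) $\{f>0\}$ is an open interval $(r,s)$ with $-\infty\le r<s\le\infty$, that $q>0$ on $(r,s)$ and that $f$ is infinitely differentiable on $(r,s)$. "$g$ has $k$-th derivative $g^{(k)}$" means, for $k\ge1$, that $g$ is $k-1$ times continuously differentiable on $(r,s)$, $g^{(k-1)}$ is locally absolutely continuous on $(r,s)$, and $g^{(k)}$ is its almost everywhere derivative; for $k=0$, $g$ is Borel measurable and $g^{(0)}=g$. *)

theory Defs
  imports "HOL-Probability.Probability"
begin

definition absolutely_continuous_on :: "real set \<Rightarrow> (real \<Rightarrow> real) \<Rightarrow> bool" where
  "absolutely_continuous_on S g \<longleftrightarrow>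
     (\<forall>\<epsilon>>0. \<exists>d>0. \<forall>n::nat. \<forall>a b :: nat \<Rightarrow> real.
        (\<forall>i<n. a i \<le> b i \<and> {a i..b i} \<subseteq> S) \<and>
        disjoint_family_on (\<lambda>i. {a i<..<b i}) {..<n} \<and>
        (\<Sum>i<n. b i - a i) < d
        \<longrightarrow> (\<Sum>i<n. \<bar>g (b i) - g (a i)\<bar>) < \<epsilon>)"

definition locally_absolutely_continuous_on :: "real set \<Rightarrow> (real \<Rightarrow> real) \<Rightarrow> bool" where
  "locally_absolutely_continuous_on S g \<longleftrightarrow>
     (\<forall>c d. c \<le> d \<and> {c..d} \<subseteq> S \<longrightarrow> absolutely_continuous_on {c..d} g)"

(* Meant for open S, on which the iterated derivative of g depends only on the values
   of g on S; continuity of the derivatives of order i < n follows from differentiability. *)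
definition times_cont_differentiable_on :: "nat \<Rightarrow> (real \<Rightarrow> real) \<Rightarrow> real set \<Rightarrow> bool" where
  "times_cont_differentiable_on n g S \<longleftrightarrow>
     (\<forall>i<n. \<forall>x\<in>S. (deriv ^^ i) g field_differentiable (at x)) \<and>
     continuous_on S ((deriv ^^ n) g)"

(* For k \<ge> 1 the k-th derivative is determined by g only up to null sets; h may be any
   Borel measurable version of it (without measurability, integrals involving h are
   meaningless). Nothing is required of g and h outside (r, s). *)
definition has_kth_derivative :: "nat \<Rightarrow> (real \<Rightarrow> real) \<Rightarrow> (real \<Rightarrow> real) \<Rightarrow> ereal \<Rightarrow> ereal \<Rightarrow> bool" where
  "has_kth_derivative k g h r s \<longleftrightarrow>
     h \<in> borel_measurable (restrict_space borel (einterval r s)) \<and>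
     (if k = 0 then \<forall>x\<in>einterval r s. h x = g x
      else times_cont_differentiable_on (k - 1) g (einterval r s) \<and>
           locally_absolutely_continuous_on (einterval r s) ((deriv ^^ (k - 1)) g) \<and>
           (AE x in lborel. x \<in> einterval r s \<longrightarrow>
              ((deriv ^^ (k - 1)) g has_real_derivative h x) (at x)))"

definition rodrigues :: "(real \<Rightarrow> real) \<Rightarrow> (real \<Rightarrow> real) \<Rightarrow> nat \<Rightarrow> real \<Rightarrow> real" where
  "rodrigues q f k x = (-1) ^ k / f x * (deriv ^^ k) (\<lambda>y. q y ^ k * f y) x"

end

(* The Pearson identity says that H = Q f is an antiderivative of (\<mu> - x) f, so f is smooth on (r, s) and
   Q f' = (\<mu> - x - Q') f. Hence the j-th derivative of Q^k f is Q^(k-j) p_j f with a polynomial p_j of degree at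
   most j, and P_k is a polynomial of degree at most k. Polynomials times H vanish at r and s as far as the moments
   allow: at a finite endpoint by continuity, at an infinite one because H is a tail integral of (t - \<mu>) f. This
   makes all boundary terms of the repeated integration by parts in (a) vanish and also shows that P_k f is
   orthogonal to polynomials of degree less than k. For (b), replace g by its Taylor polynomial, which integrates to zero
   against P_k f, plus the integral remainder, and apply Fubini: by (a) the inner integral is Q^k f, and since P_k has
   constant sign near r and s, the integral of the absolute value is at most a multiple of Q^k f. *)

theory Submission
  imports Defs "HOL-Computational_Algebra.Polynomial"
begin

subsection \<open>Absolutely continuous functions and Taylor expansions\<close>

text \<open>In (b) the hypotheses bound only the \<open>k\<close>-th derivative of \<open>g\<close>,
  so direct integration by parts would leave boundary terms in \<open>g\<close> and its lower
  derivatives with no evident control. Expanding about one interior point \<open>z\<close> avoids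
  them: pointwise questions about \<open>g\<close> stay on compact subintervals of the support,
  where q^k f has a positive lower bound, and the behaviour at the ends enters only through an
  estimate on P_k f that does not involve \<open>g\<close>. One telescoping sum serves both parts:
  with the derivatives of \<open>g\<close> as coefficients it gives the Taylor remainder, with those
  of q^k f the repeated integration by parts. The boundary terms in (a) keep at least one factor q,
  which is merged with f into H. H is continuous on the whole line, while f may jump at a finite
  endpoint. At an infinite endpoint the polynomial left beside H has degree at most 2k - 2, and H,
  as a tail integral, costs one more moment: this is where 2k - 1 comes from.\<close>

lemma iterated_deriv_eq:
  fixes F :: "nat \<Rightarrow> real \<Rightarrow> real"
  assumes "open S"
    and D: "\<And>j x. j < k \<Longrightarrow> x \<in> S \<Longrightarrow> (F j has_real_derivative F (Suc j) x) (at x)"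
    and "j \<le> k" "x \<in> S"
  shows "(deriv ^^ j) (F 0) x = F j x"
  using assms(3,4)
proof (induction j arbitrary: x)
  case (Suc j)
  have "((deriv ^^ j) (F 0) has_real_derivative F (Suc j) x) (at x)"
    by (rule has_field_derivative_transform_within_open[OF D[of j x] \<open>open S\<close>])
      (use Suc in auto)
  then show ?case by (simp add: DERIV_imp_deriv)
qed simp

text \<open>The \<open>y\<close>-derivative of each weight is minus the previous weight, so the
  product rule terms cancel in pairs and only the top one survives. The top coefficient needs a
  derivative at the single point \<open>y\<close> only, so an almost everywhere derivative can be
  plugged in.\<close>

lemma DERIV_Taylor_telescope:
  fixes F :: "nat \<Rightarrow> real \<Rightarrow> real"
  assumes "\<And>i. i < m \<Longrightarrow> (F i has_real_derivative F (Suc i) y) (at y)"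
    and "(F m has_real_derivative D) (at y)"
  shows "((\<lambda>y. \<Sum>i\<le>m. F i y * ((x - y) ^ i / fact i)) has_real_derivative
           D * ((x - y) ^ m / fact m)) (at y)"
  using assms
proof (induction m arbitrary: D)
  case (Suc m)
  have IH: "((\<lambda>y. \<Sum>i\<le>m. F i y * ((x - y) ^ i / fact i)) has_real_derivative
           F (Suc m) y * ((x - y) ^ m / fact m)) (at y)"
    by (rule Suc.IH) (use Suc.prems in auto)
  have p: "((\<lambda>y. (x - y) ^ Suc m / fact (Suc m)) has_real_derivative - ((x - y) ^ m / fact m)) (at y)"
  proof -
    have "((\<lambda>y. (x - y) ^ Suc m) has_real_derivative - (real (Suc m) * (x - y) ^ m)) (at y)"
      by (auto intro!: derivative_eq_intros simp del: power_Suc)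
    from DERIV_cdivide[OF this, of "fact (Suc m)"] show ?thesis
      by (simp add: fact_Suc del: of_nat_Suc power_Suc)
  qed
  have "((\<lambda>y. F (Suc m) y * ((x - y) ^ Suc m / fact (Suc m))) has_real_derivative
      D * ((x - y) ^ Suc m / fact (Suc m)) + - ((x - y) ^ m / fact m) * F (Suc m) y) (at y)"
    by (rule DERIV_mult[OF Suc.prems(2) p])
  from DERIV_add[OF IH this] show ?case by (simp add: mult.commute)
qed simp

lemma Taylor_sum_diag:
  fixes c :: "nat \<Rightarrow> real"
  shows "(\<Sum>i\<le>m. c i * ((x - x) ^ i / fact i)) = c 0"
proof -
  have "(\<Sum>i\<le>m. c i * ((x - x) ^ i / fact i)) = (\<Sum>i\<le>m. if i = 0 then c 0 else 0)"
    by (intro sum.cong) (auto simp: power_0_left)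
  then show ?thesis by simp
qed

lemma bounded_on_Icc:
  assumes "continuous_on {a..b} (u :: real \<Rightarrow> real)"
  obtains A where "A \<ge> 0" "\<And>y. y \<in> {a..b} \<Longrightarrow> \<bar>u y\<bar> \<le> A"
proof -
  obtain A where "\<forall>y\<in>{a..b}. \<bar>u y\<bar> \<le> A"
    using compact_imp_bounded[OF compact_continuous_image[OF assms]] by (auto simp: bounded_real)
  then have "\<bar>u y\<bar> \<le> max A 0" if "y \<in> {a..b}" for y using that by (auto simp: le_max_iff_disj)
  then show ?thesis using that[of "max A 0"] by simp
qed

section \<open>Absolute continuity and its fundamental theorem of calculus\<close>

lemma absolutely_continuous_onE:
  assumes "absolutely_continuous_on S g" "\<epsilon> > 0"
  obtains d where "d > 0" and "\<And>n a b. \<lbrakk>\<forall>i<n. a i \<le> b i \<and> {a i..b i} \<subseteq> S;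
        disjoint_family_on (\<lambda>i. {a i<..<b i}) {..<n::nat}; (\<Sum>i<n. b i - a i) < d\<rbrakk>
        \<Longrightarrow> (\<Sum>i<n. \<bar>g (b i) - g (a i)\<bar>) < \<epsilon>"
  using assms unfolding absolutely_continuous_on_def by meson

text \<open>Enumerating the index set frees the definition from natural number indices; the gauge
  argument below indexes intervals by the tagged pairs of a division.\<close>

lemma absolutely_continuous_on_finiteE:
  assumes "absolutely_continuous_on S g" "\<epsilon> > 0"
  obtains d where "d > 0" and "\<And>I (a :: 'i \<Rightarrow> real) b. \<lbrakk>finite I; \<forall>i\<in>I. a i \<le> b i \<and> {a i..b i} \<subseteq> S;
    disjoint_family_on (\<lambda>i. {a i<..<b i}) I; (\<Sum>i\<in>I. b i - a i) < d\<rbrakk> \<Longrightarrow>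
    (\<Sum>i\<in>I. \<bar>g (b i) - g (a i)\<bar>) < \<epsilon>"
proof -
  obtain d where "d > 0" and d: "\<And>n a b. \<lbrakk>\<forall>i<n. a i \<le> b i \<and> {a i..b i} \<subseteq> S;
        disjoint_family_on (\<lambda>i. {a i<..<b i}) {..<n::nat}; (\<Sum>i<n. b i - a i) < d\<rbrakk>
        \<Longrightarrow> (\<Sum>i<n. \<bar>g (b i) - g (a i)\<bar>) < \<epsilon>"
    by (rule absolutely_continuous_onE[OF assms]) (rule that)
  show ?thesis
  proof (rule that[OF \<open>d > 0\<close>])
    fix I :: "'i set" and a b :: "'i \<Rightarrow> real"
    assume I: "finite I" and ab: "\<forall>i\<in>I. a i \<le> b i \<and> {a i..b i} \<subseteq> S"
      and disj: "disjoint_family_on (\<lambda>i. {a i<..<b i}) I" and len: "(\<Sum>i\<in>I. b i - a i) < d"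
    obtain e where e: "bij_betw e {..<card I} I"
      using ex_bij_betw_nat_finite[OF I] by (auto simp: atLeast0LessThan)
    have eI: "e i \<in> I" if "i < card I" for i
      using e that by (auto simp: bij_betw_def)
    have "(\<Sum>i<card I. \<bar>g (b (e i)) - g (a (e i))\<bar>) < \<epsilon>"
    proof (rule d)
      show "\<forall>i<card I. a (e i) \<le> b (e i) \<and> {a (e i)..b (e i)} \<subseteq> S" using ab eI by blast
      show "disjoint_family_on (\<lambda>i. {a (e i)<..<b (e i)}) {..<card I}"
        using disj e unfolding disjoint_family_on_def bij_betw_def
        by (metis eI inj_on_contraD lessThan_iff)
      show "(\<Sum>i<card I. b (e i) - a (e i)) < d"
        using len sum.reindex_bij_betw[OF e, of "\<lambda>i. b i - a i"] by simp
    qed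
    then show "(\<Sum>i\<in>I. \<bar>g (b i) - g (a i)\<bar>) < \<epsilon>"
      using sum.reindex_bij_betw[OF e, of "\<lambda>i. \<bar>g (b i) - g (a i)\<bar>"] by simp
  qed
qed

text \<open>Shaped for Taylor sums: \<open>G\<close> is the top derivative, merely absolutely
  continuous, \<open>p\<close> its smooth weight, and \<open>u\<close> collects the remaining
  summands, which are Lipschitz on compact intervals.\<close>

lemma absolutely_continuous_on_add_mult_lipschitz:
  assumes ac: "absolutely_continuous_on S G"
    and A: "\<And>y. y \<in> S \<Longrightarrow> \<bar>G y\<bar> \<le> A" and B: "\<And>y. y \<in> S \<Longrightarrow> \<bar>p y\<bar> \<le> B"
    and L: "\<And>y z. y \<in> S \<Longrightarrow> z \<in> S \<Longrightarrow> \<bar>p z - p y\<bar> \<le> L * \<bar>z - y\<bar>"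
    and K: "\<And>y z. y \<in> S \<Longrightarrow> z \<in> S \<Longrightarrow> \<bar>u z - u y\<bar> \<le> K * \<bar>z - y\<bar>"
  shows "absolutely_continuous_on S (\<lambda>y. u y + G y * p y)"
  unfolding absolutely_continuous_on_def
proof (intro allI impI)
  fix \<epsilon> :: real assume "\<epsilon> > 0"
  \<comment> \<open>Half of \<epsilon> pays for the variation of \<open>G\<close>, half for the
    total length. The \<open>+ 1\<close> keeps both divisors positive; absolute values are taken
    because the given bounds may be negative when \<open>S\<close> is too small to constrain
    them.\<close>
  define B' where "B' = \<bar>B\<bar> + 1"
  define C where "C = \<bar>A\<bar> * \<bar>L\<bar> + \<bar>K\<bar> + 1"
  have pos: "B' > 0" "C > 0" by (auto simp: B'_def C_def add_nonneg_pos)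
  obtain d where "d > 0" and d: "\<And>n a b. \<lbrakk>\<forall>i<n. a i \<le> b i \<and> {a i..b i} \<subseteq> S;
        disjoint_family_on (\<lambda>i. {a i<..<b i}) {..<n::nat}; (\<Sum>i<n. b i - a i) < d\<rbrakk>
        \<Longrightarrow> (\<Sum>i<n. \<bar>G (b i) - G (a i)\<bar>) < \<epsilon> / (2 * B')"
    by (rule absolutely_continuous_onE[OF ac, of "\<epsilon> / (2 * B')"])
      (use \<open>\<epsilon> > 0\<close> pos in simp, rule that)
  show "\<exists>d>0. \<forall>n::nat. \<forall>a b. (\<forall>i<n. a i \<le> b i \<and> {a i..b i} \<subseteq> S) \<and>
        disjoint_family_on (\<lambda>i. {a i<..<b i}) {..<n} \<and> (\<Sum>i<n. b i - a i) < d \<longrightarrow>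
        (\<Sum>i<n. \<bar>u (b i) + G (b i) * p (b i) - (u (a i) + G (a i) * p (a i))\<bar>) < \<epsilon>"
  proof (intro exI[of _ "min d (\<epsilon> / (2 * C))"] conjI allI impI)
    show "min d (\<epsilon> / (2 * C)) > 0" using \<open>d > 0\<close> \<open>\<epsilon> > 0\<close> pos by simp
    fix n and a b :: "nat \<Rightarrow> real"
    assume as: "(\<forall>i<n. a i \<le> b i \<and> {a i..b i} \<subseteq> S) \<and>
        disjoint_family_on (\<lambda>i. {a i<..<b i}) {..<n} \<and> (\<Sum>i<n. b i - a i) < min d (\<epsilon> / (2 * C))"
    have 1: "(\<Sum>i<n. \<bar>G (b i) - G (a i)\<bar>) < \<epsilon> / (2 * B')" by (rule d) (use as in auto)
    have 2: "\<bar>u (b i) + G (b i) * p (b i) - (u (a i) + G (a i) * p (a i))\<bar>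
        \<le> B' * \<bar>G (b i) - G (a i)\<bar> + C * (b i - a i)" if "i < n" for i
    proof -
      have S: "a i \<in> S" "b i \<in> S" "a i \<le> b i" using as that by (auto simp: subset_iff)
      have "u (b i) + G (b i) * p (b i) - (u (a i) + G (a i) * p (a i)) =
        (G (b i) - G (a i)) * p (b i) + (G (a i) * (p (b i) - p (a i)) + (u (b i) - u (a i)))"
        by (simp add: algebra_simps)
      also have "\<bar>\<dots>\<bar> \<le> \<bar>G (b i) - G (a i)\<bar> * \<bar>p (b i)\<bar> +
          (\<bar>G (a i)\<bar> * \<bar>p (b i) - p (a i)\<bar> + \<bar>u (b i) - u (a i)\<bar>)"
        by (intro order.trans[OF abs_triangle_ineq] add_mono) (auto simp: abs_mult)
      also have "\<dots> \<le> \<bar>G (b i) - G (a i)\<bar> * B' + (\<bar>A\<bar> * (\<bar>L\<bar> * (b i - a i)) + \<bar>K\<bar> * (b i - a i))"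
      proof (intro add_mono mult_mono)
        show "\<bar>p (b i)\<bar> \<le> B'" using B[OF S(2)] by (simp add: B'_def)
        show "\<bar>G (a i)\<bar> \<le> \<bar>A\<bar>" using A[OF S(1)] by simp
        have "\<bar>p (b i) - p (a i)\<bar> \<le> L * (b i - a i)" using L[OF S(1,2)] S by simp
        also have "\<dots> \<le> \<bar>L\<bar> * (b i - a i)" using S by (intro mult_right_mono) auto
        finally show "\<bar>p (b i) - p (a i)\<bar> \<le> \<bar>L\<bar> * (b i - a i)" .
        have "\<bar>u (b i) - u (a i)\<bar> \<le> K * (b i - a i)" using K[OF S(1,2)] S by simp
        also have "\<dots> \<le> \<bar>K\<bar> * (b i - a i)" using S by (intro mult_right_mono) auto
        finally show "\<bar>u (b i) - u (a i)\<bar> \<le> \<bar>K\<bar> * (b i - a i)" .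
      qed auto
      also have "\<dots> \<le> B' * \<bar>G (b i) - G (a i)\<bar> + C * (b i - a i)"
        using S by (simp add: C_def algebra_simps)
      finally show ?thesis .
    qed
    have "(\<Sum>i<n. \<bar>u (b i) + G (b i) * p (b i) - (u (a i) + G (a i) * p (a i))\<bar>)
        \<le> (\<Sum>i<n. B' * \<bar>G (b i) - G (a i)\<bar> + C * (b i - a i))"
      by (intro sum_mono 2) auto
    also have "\<dots> = B' * (\<Sum>i<n. \<bar>G (b i) - G (a i)\<bar>) + C * (\<Sum>i<n. b i - a i)"
      by (simp add: sum.distrib sum_distrib_left)
    also have "\<dots> < B' * (\<epsilon> / (2 * B')) + C * (\<epsilon> / (2 * C))"
      using 1 as pos by (intro add_strict_mono mult_strict_left_mono) auto
    also have "\<dots> = \<epsilon>" using pos by (simp add: field_simps)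
    finally show "(\<Sum>i<n. \<bar>u (b i) + G (b i) * p (b i) - (u (a i) + G (a i) * p (a i))\<bar>) < \<epsilon>" .
  qed
qed

text \<open>With the tag \<open>x\<close> between \<open>u\<close> and \<open>v\<close>, the two
  one-sided errors are proportional to \<open>v - x\<close> and \<open>x - u\<close>, which add up
  to exactly \<open>v - u\<close>.\<close>

lemma straddle_bound:
  fixes G :: "real \<Rightarrow> real"
  assumes "(G has_real_derivative D) (at x)" "e > 0"
  shows "\<exists>d>0. \<forall>u v. u \<le> x \<and> x \<le> v \<and> {u..v} \<subseteq> ball x d \<longrightarrow> \<bar>(v - u) * D - (G v - G u)\<bar> \<le> e * (v - u)"
proof -
  obtain d where "d > 0" and d: "\<And>y. \<bar>y - x\<bar> < d \<Longrightarrow> \<bar>G y - G x - D * (y - x)\<bar> \<le> e * \<bar>y - x\<bar>"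
    using assms unfolding has_field_derivative_def has_derivative_at_alt real_norm_def by blast
  have "\<bar>(v - u) * D - (G v - G u)\<bar> \<le> e * (v - u)" if "u \<le> x" "x \<le> v" "{u..v} \<subseteq> ball x d" for u v
  proof -
    have "u \<in> {u..v}" "v \<in> {u..v}" using that by auto
    then have "u \<in> ball x d" "v \<in> ball x d" using that(3) by blast+
    then have "\<bar>G v - G x - D * (v - x)\<bar> \<le> e * (v - x)" "\<bar>G u - G x - D * (u - x)\<bar> \<le> e * (x - u)"
      using d[of u] d[of v] that by (auto simp: dist_real_def)
    then show ?thesis by (simp add: abs_le_iff algebra_simps)
  qed
  with \<open>d > 0\<close> show ?thesis by blast
qed

lemma sum_length_le_measure:
  assumes I: "finite I" and ab: "\<And>i. i \<in> I \<Longrightarrow> a i \<le> b i \<and> {a i<..<b i} \<subseteq> U"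
    and disj: "disjoint_family_on (\<lambda>i. {a i<..<b i::real}) I" and U: "U \<in> sets lborel" "emeasure lborel U < ennreal d"
  shows "(\<Sum>i\<in>I. b i - a i) < d"
proof -
  have "ennreal (\<Sum>i\<in>I. b i - a i) = (\<Sum>i\<in>I. ennreal (b i - a i))"
    using ab by (simp add: sum_ennreal)
  also have "\<dots> = (\<Sum>i\<in>I. emeasure lborel {a i<..<b i})"
    by (intro sum.cong refl) (use ab in auto)
  also have "\<dots> = emeasure lborel (\<Union>i\<in>I. {a i<..<b i})"
    by (rule sum_emeasure) (use I disj in auto)
  also have "\<dots> \<le> emeasure lborel U" using ab U by (intro emeasure_mono) auto
  also note U(2)
  finally show ?thesis using ab by (subst (asm) ennreal_less_iff) (auto intro!: sum_nonneg)
qed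

text \<open>The gauge is chosen separately on the exceptional null set, where it keeps the tagged intervals
  inside an open set of small measure, so that absolute continuity bounds their contribution.
  Thus integrability of the derivative is a conclusion rather than a hypothesis.\<close>

lemma absolutely_continuous_on_has_integral:
  assumes "c \<le> d" and ac: "absolutely_continuous_on {c..d} G"
    and ae: "AE x in lborel. x \<in> {c..d} \<longrightarrow> (G has_real_derivative h x) (at x)"
  shows "(h has_integral (G d - G c)) {c..d}"
proof -
  obtain N where N: "N \<in> null_sets lborel"
    and der: "\<And>x. x \<notin> N \<Longrightarrow> x \<in> {c..d} \<Longrightarrow> (G has_real_derivative h x) (at x)"
    using AE_E3[OF ae] by auto
  have negl: "negligible N" using N by (simp add: negligible_iff_null_sets null_sets_completionI)
  \<comment> \<open>Nothing is known about \<open>h\<close> on \<open>N\<close>. With the value 0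
    there, a tag in \<open>N\<close> contributes only the increment of \<open>G\<close>.\<close>
  define h0 where "h0 x = (if x \<in> N then 0 else h x)" for x
  have "(h0 has_integral (G d - G c)) {c..d}"
    unfolding has_integral_real
  proof (intro allI impI)
    fix e :: real assume "e > 0"
    \<comment> \<open>The \<open>+ 1\<close> covers \<open>c = d\<close> and makes the total error
      of the good tags strictly less than \<open>e / 2\<close>.\<close>
    define e' where "e' = e / (2 * (d - c + 1))"
    have e': "e' > 0" "e' * (d - c) < e / 2"
      using \<open>e > 0\<close> \<open>c \<le> d\<close> by (auto simp: e'_def field_simps)
    obtain \<eta> where "\<eta> > 0" and \<eta>: "\<And>I (a :: real \<times> real set \<Rightarrow> real) b. \<lbrakk>finite I;
        \<forall>i\<in>I. a i \<le> b i \<and> {a i..b i} \<subseteq> {c..d}; disjoint_family_on (\<lambda>i. {a i<..<b i}) I;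
        (\<Sum>i\<in>I. b i - a i) < \<eta>\<rbrakk> \<Longrightarrow> (\<Sum>i\<in>I. \<bar>G (b i) - G (a i)\<bar>) < e / 2"
      by (rule absolutely_continuous_on_finiteE[OF ac half_gt_zero[OF \<open>e > 0\<close>]]) (rule that)
    have "N \<in> sets lebesgue" using N by auto
    then obtain U where U: "open U" "N \<subseteq> U" "emeasure lebesgue (U - N) < ennreal \<eta>"
      using sets_lebesgue_outer_open[OF _ \<open>\<eta> > 0\<close>] by metis
    have Um: "emeasure lborel U < ennreal \<eta>"
    proof -
      have "U - N \<in> sets lborel" using U(1) null_setsD2[OF N] by simp
      then have "emeasure lebesgue (U - N) = emeasure lborel (U - N)" by simp
      also have "\<dots> = emeasure lborel U" using U(1) N by (intro emeasure_Diff_null_set) auto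
      finally show ?thesis using U(3) by simp
    qed
    have "\<exists>\<delta>>0. x \<in> {c..d} - N \<longrightarrow> (\<forall>u v. u \<le> x \<and> x \<le> v \<and> {u..v} \<subseteq> ball x \<delta> \<longrightarrow>
        \<bar>(v - u) * h x - (G v - G u)\<bar> \<le> e' * (v - u))" for x
      using straddle_bound[OF der e'(1), of x] by (cases "x \<in> {c..d} - N") (auto intro: exI[of _ 1])
    then obtain \<delta> where \<delta>: "\<And>x. \<delta> x > 0"
      "\<And>x u v. x \<in> {c..d} - N \<Longrightarrow> u \<le> x \<Longrightarrow> x \<le> v \<Longrightarrow> {u..v} \<subseteq> ball x (\<delta> x) \<Longrightarrow>
        \<bar>(v - u) * h x - (G v - G u)\<bar> \<le> e' * (v - u)" by metis
    define \<gamma> where "\<gamma> x = (if x \<in> N then U else ball x (\<delta> x))" for x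
    show "\<exists>\<gamma>. gauge \<gamma> \<and> (\<forall>\<D>. \<D> tagged_division_of {c..d} \<and> \<gamma> fine \<D> \<longrightarrow>
        norm ((\<Sum>(x, k)\<in>\<D>. measure lborel k *\<^sub>R h0 x) - (G d - G c)) < e)"
    proof (intro exI[of _ \<gamma>] conjI allI impI)
      show "gauge \<gamma>" using U \<delta>(1) by (auto simp: gauge_def \<gamma>_def)
      fix \<D> assume "\<D> tagged_division_of {c..d} \<and> \<gamma> fine \<D>"
      then have D: "\<D> tagged_division_of {c..d}" and fine: "\<gamma> fine \<D>" by auto
      note fin = tagged_division_ofD(1)[OF D]
      have K: "snd xk = {Inf (snd xk)..Sup (snd xk)}" "fst xk \<in> snd xk" "snd xk \<subseteq> {c..d}"
        "Inf (snd xk) \<le> fst xk" "fst xk \<le> Sup (snd xk)" "snd xk \<subseteq> \<gamma> (fst xk)"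
        if mem: "xk \<in> \<D>" for xk
      proof -
        obtain x k where xk: "xk = (x, k)" by force
        obtain a b where k: "k = cbox a b" using tagged_division_ofD(4)[OF D] mem xk by blast
        have "x \<in> k" "k \<subseteq> {c..d}" using tagged_division_ofD(2,3)[OF D] mem xk by auto
        moreover have "k \<subseteq> \<gamma> x" using fineD[OF fine] mem xk by blast
        ultimately show "snd xk = {Inf (snd xk)..Sup (snd xk)}" "fst xk \<in> snd xk" "snd xk \<subseteq> {c..d}"
          "Inf (snd xk) \<le> fst xk" "fst xk \<le> Sup (snd xk)" "snd xk \<subseteq> \<gamma> (fst xk)"
          using k xk by auto
      qed
      define l where "l xk = Sup (snd xk) - Inf (snd xk)" for xk :: "real \<times> real set"
      define \<Delta> where "\<Delta> xk = G (Sup (snd xk)) - G (Inf (snd xk))" for xk :: "real \<times> real set"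
      have cl: "measure lborel (snd xk) = l xk" if "xk \<in> \<D>" for xk
        using K[OF that] unfolding l_def by (metis atLeastatMost_empty_iff2 content_real empty_iff linorder_le_cases)
      have sumG: "(\<Sum>xk\<in>\<D>. \<Delta> xk) = G d - G c"
        using additive_tagged_division_1[OF \<open>c \<le> d\<close> D, of G] by (simp add: \<Delta>_def case_prod_unfold)
      have suml: "(\<Sum>xk\<in>\<D>. l xk) = d - c"
        using additive_tagged_division_1[OF \<open>c \<le> d\<close> D, of "\<lambda>x. x"] by (simp add: l_def case_prod_unfold)
      have l0: "l xk \<ge> 0" if "xk \<in> \<D>" for xk using K[OF that] by (auto simp: l_def)
      define \<D>N where "\<D>N = {xk\<in>\<D>. fst xk \<in> N}"
      have good: "(\<Sum>xk\<in>\<D> - \<D>N. \<bar>l xk * h0 (fst xk) - \<Delta> xk\<bar>) \<le> e' * (d - c)"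
      proof -
        have "(\<Sum>xk\<in>\<D> - \<D>N. \<bar>l xk * h0 (fst xk) - \<Delta> xk\<bar>) \<le> (\<Sum>xk\<in>\<D> - \<D>N. e' * l xk)"
        proof (rule sum_mono)
          fix xk assume "xk \<in> \<D> - \<D>N"
          then have xk: "xk \<in> \<D>" "fst xk \<notin> N" by (auto simp: \<D>N_def)
          have "fst xk \<in> {c..d} - N" using K(2,3)[OF xk(1)] xk(2) by blast
          moreover have "{Inf (snd xk)..Sup (snd xk)} \<subseteq> ball (fst xk) (\<delta> (fst xk))"
            using K(1,6)[OF xk(1)] xk(2) by (simp add: \<gamma>_def)
          ultimately show "\<bar>l xk * h0 (fst xk) - \<Delta> xk\<bar> \<le> e' * l xk"
            using \<delta>(2)[of "fst xk" "Inf (snd xk)" "Sup (snd xk)"] K(4,5)[OF xk(1)] xk(2)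
            by (simp add: l_def \<Delta>_def h0_def)
        qed
        also have "\<dots> \<le> (\<Sum>xk\<in>\<D>. e' * l xk)"
          using fin l0 e' by (intro sum_mono2) auto
        also have "\<dots> = e' * (d - c)" by (simp add: suml flip: sum_distrib_left)
        finally show ?thesis .
      qed
      have disj: "disjoint_family_on (\<lambda>xk. {Inf (snd xk)<..<Sup (snd xk)}) \<D>N"
        unfolding disjoint_family_on_def
      proof (intro ballI impI)
        fix p p' assume p: "p \<in> \<D>N" "p' \<in> \<D>N" "p \<noteq> p'"
        then have "interior (snd p) \<inter> interior (snd p') = {}"
          using tagged_division_ofD(5)[OF D, of "fst p" "snd p" "fst p'" "snd p'"] by (auto simp: \<D>N_def)
        moreover have "interior (snd p) = {Inf (snd p)<..<Sup (snd p)}"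
           "interior (snd p') = {Inf (snd p')<..<Sup (snd p')}"
          using K(1)[of p] K(1)[of p'] p by (metis (no_types, lifting) \<D>N_def interior_atLeastAtMost_real mem_Collect_eq)+
        ultimately show "{Inf (snd p)<..<Sup (snd p)} \<inter> {Inf (snd p')<..<Sup (snd p')} = {}" by simp
      qed
      have bad: "(\<Sum>xk\<in>\<D>N. \<bar>l xk * h0 (fst xk) - \<Delta> xk\<bar>) < e / 2"
      proof -
        have ND: "xk \<in> \<D>" "fst xk \<in> N" if "xk \<in> \<D>N" for xk using that by (auto simp: \<D>N_def)
        have finN: "finite \<D>N" using fin by (auto simp: \<D>N_def)
        have "(\<Sum>xk\<in>\<D>N. \<bar>l xk * h0 (fst xk) - \<Delta> xk\<bar>) = (\<Sum>xk\<in>\<D>N. \<bar>G (Sup (snd xk)) - G (Inf (snd xk))\<bar>)"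
          by (intro sum.cong refl) (auto simp: \<D>N_def h0_def \<Delta>_def)
        also have "\<dots> < e / 2"
        proof (rule \<eta>[OF finN _ disj])
          show "\<forall>i\<in>\<D>N. Inf (snd i) \<le> Sup (snd i) \<and> {Inf (snd i)..Sup (snd i)} \<subseteq> {c..d}"
            using K(1,3,4,5)[OF ND(1)] order_trans by blast
          show "(\<Sum>i\<in>\<D>N. Sup (snd i) - Inf (snd i)) < \<eta>"
          proof (rule sum_length_le_measure[OF finN _ disj _ Um])
            fix i assume i: "i \<in> \<D>N"
            have "snd i \<subseteq> U" using K(6)[OF ND(1)[OF i]] ND(2)[OF i] by (simp add: \<gamma>_def)
            then have "{Inf (snd i)..Sup (snd i)} \<subseteq> U" using K(1)[OF ND(1)[OF i]] by simp
            moreover have "{Inf (snd i)<..<Sup (snd i)} \<subseteq> {Inf (snd i)..Sup (snd i)}" by auto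
            moreover have "Inf (snd i) \<le> Sup (snd i)"
              using K(4,5)[OF ND(1)[OF i]] by (rule order_trans)
            ultimately show "Inf (snd i) \<le> Sup (snd i) \<and> {Inf (snd i)<..<Sup (snd i)} \<subseteq> U"
              by blast
          qed (use U in auto)
        qed
        finally show ?thesis .
      qed
      have "(\<Sum>(x, k)\<in>\<D>. measure lborel k *\<^sub>R h0 x) - (G d - G c) = (\<Sum>xk\<in>\<D>. l xk * h0 (fst xk) - \<Delta> xk)"
        by (simp add: sum_subtractf sumG case_prod_unfold cl cong: sum.cong)
      also have "\<bar>\<dots>\<bar> \<le> (\<Sum>xk\<in>\<D>. \<bar>l xk * h0 (fst xk) - \<Delta> xk\<bar>)" by (rule sum_abs)
      also have "\<dots> = (\<Sum>xk\<in>\<D> - \<D>N. \<bar>l xk * h0 (fst xk) - \<Delta> xk\<bar>) + (\<Sum>xk\<in>\<D>N. \<bar>l xk * h0 (fst xk) - \<Delta> xk\<bar>)"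
        by (rule sum.subset_diff) (use fin in \<open>auto simp: \<D>N_def\<close>)
      also have "\<dots> < e" using good bad e' by linarith
      finally show "norm ((\<Sum>(x, k)\<in>\<D>. measure lborel k *\<^sub>R h0 x) - (G d - G c)) < e" by simp
    qed
  qed
  then show ?thesis by (rule has_integral_spike[OF negl, rotated]) (auto simp: h0_def)
qed

text \<open>The sum \<open>\<Psi>\<close> is viewed as a function of the expansion point, so its
  almost everywhere derivative telescopes to the integrand. The integral obtained is a gauge
  integral; Lebesgue integrability of \<open>h\<close> on compact intervals is added later from the
  weighted hypothesis.\<close>

lemma has_kth_derivative_Taylor_integral:
  fixes g h :: "real \<Rightarrow> real" and x :: real
  assumes der: "has_kth_derivative (Suc m) g h r s"
    and cd: "c \<le> d" "{c..d} \<subseteq> einterval r s"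
  defines "\<Psi> \<equiv> \<lambda>y. \<Sum>i\<le>m. (deriv ^^ i) g y * ((x - y) ^ i / fact i)"
  shows "((\<lambda>y. h y * ((x - y) ^ m / fact m)) has_integral (\<Psi> d - \<Psi> c)) {c..d}"
proof (rule absolutely_continuous_on_has_integral[OF cd(1), where G = \<Psi>])
  let ?G = "\<lambda>i. (deriv ^^ i) g"
  let ?p = "\<lambda>i y. (x - y) ^ i / fact i"
  have tcd: "times_cont_differentiable_on m g (einterval r s)"
    and lac: "locally_absolutely_continuous_on (einterval r s) (?G m)"
    and ae: "AE x in lborel. x \<in> einterval r s \<longrightarrow> (?G m has_real_derivative h x) (at x)"
    using der by (auto simp: has_kth_derivative_def)
  have D: "(?G i has_real_derivative ?G (Suc i) y) (at y)" if "i < m" "y \<in> einterval r s" for i y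
    using tcd that unfolding times_cont_differentiable_on_def by (simp add: DERIV_deriv_iff_field_differentiable)
  have cont: "continuous_on {c..d} (?G m)"
    using tcd cd continuous_on_subset unfolding times_cont_differentiable_on_def by blast
  have bdd: "\<exists>A. \<forall>y\<in>{c..d}. \<bar>u y\<bar> \<le> A" if "continuous_on {c..d} u" for u :: "real \<Rightarrow> real"
    using bounded_on_Icc[OF that] by metis
  have lip: "\<exists>L. \<forall>y\<in>{c..d}. \<forall>z\<in>{c..d}. \<bar>u z - u y\<bar> \<le> L * \<bar>z - y\<bar>"
    if der_u: "\<And>y. y \<in> {c..d} \<Longrightarrow> (u has_real_derivative u' y) (at y)" and cont_u: "continuous_on {c..d} u'" for u u' :: "real \<Rightarrow> real"
  proof -
    obtain L where L: "\<forall>y\<in>{c..d}. \<bar>u' y\<bar> \<le> L" using bdd[OF cont_u] by blast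
    have "\<bar>u z - u y\<bar> \<le> L * \<bar>z - y\<bar>" if "y \<in> {c..d}" "z \<in> {c..d}" for y z
      using field_differentiable_bound[of "{c..d}" u u' L z y] L that der_u
      by (auto intro: has_field_derivative_at_within)
    then show ?thesis by blast
  qed
  \<comment> \<open>All summands but the top one. Telescoping one order lower gives \<open>u\<close>
    the continuous derivative \<open>?G m y * ?p (m - 1) y\<close> for positive \<open>m\<close>,
    hence a Lipschitz bound.\<close>
  define u where "u y = (\<Sum>i<m. ?G i y * ?p i y)" for y
  have "\<exists>K. \<forall>y\<in>{c..d}. \<forall>z\<in>{c..d}. \<bar>u z - u y\<bar> \<le> K * \<bar>z - y\<bar>"
  proof (cases m)
    case 0
    then show ?thesis by (auto simp: u_def intro!: exI[of _ 0])
  next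
    case (Suc n)
    show ?thesis
    proof (rule lip[where u' = "\<lambda>y. ?G m y * ?p n y"])
      fix y assume "y \<in> {c..d}"
      then have "y \<in> einterval r s" using cd by auto
      then show "(u has_real_derivative ?G m y * ?p n y) (at y)"
        using DERIV_Taylor_telescope[of n ?G y "?G m y" x] D Suc
        by (simp add: u_def[abs_def] lessThan_Suc_atMost)
    next
      show "continuous_on {c..d} (\<lambda>y. ?G m y * ?p n y)"
        by (intro continuous_intros cont) auto
    qed
  qed
  then obtain K where K: "\<And>y z. y \<in> {c..d} \<Longrightarrow> z \<in> {c..d} \<Longrightarrow> \<bar>u z - u y\<bar> \<le> K * \<bar>z - y\<bar>" by blast
  obtain A where A: "\<And>y. y \<in> {c..d} \<Longrightarrow> \<bar>?G m y\<bar> \<le> A" using bdd[OF cont] by blast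
  have contp: "continuous_on {c..d} (?p m)" by (intro continuous_intros) auto
  obtain B where B: "\<And>y. y \<in> {c..d} \<Longrightarrow> \<bar>?p m y\<bar> \<le> B" using bdd[OF contp] by blast
  have "\<exists>L. \<forall>y\<in>{c..d}. \<forall>z\<in>{c..d}. \<bar>?p m z - ?p m y\<bar> \<le> L * \<bar>z - y\<bar>"
    by (rule lip[of _ "\<lambda>y. - (real m * (x - y) ^ (m - 1)) / fact m"])
      (auto intro!: derivative_eq_intros continuous_intros)
  then obtain L where L: "\<And>y z. y \<in> {c..d} \<Longrightarrow> z \<in> {c..d} \<Longrightarrow> \<bar>?p m z - ?p m y\<bar> \<le> L * \<bar>z - y\<bar>" by blast
  have "absolutely_continuous_on {c..d} (?G m)"
    using lac cd by (simp add: locally_absolutely_continuous_on_def)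
  from absolutely_continuous_on_add_mult_lipschitz[OF this A B L K]
  have "absolutely_continuous_on {c..d} (\<lambda>y. u y + ?G m y * ?p m y)" by blast
  then show "absolutely_continuous_on {c..d} \<Psi>"
    by (simp add: \<Psi>_def u_def lessThan_Suc_atMost[symmetric])
  show "AE y in lborel. y \<in> {c..d} \<longrightarrow> (\<Psi> has_real_derivative h y * ((x - y) ^ m / fact m)) (at y)"
    using ae
  proof eventually_elim
    case (elim y)
    show ?case
    proof
      assume "y \<in> {c..d}"
      then have "y \<in> einterval r s" using cd by auto
      then show "(\<Psi> has_real_derivative h y * ((x - y) ^ m / fact m)) (at y)"
        unfolding \<Psi>_def using D elim by (intro DERIV_Taylor_telescope) auto
    qed
  qed
qed

text \<open>Supplies the measurability of \<open>g\<close> on the support.\<close>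

lemma has_kth_derivative_continuous_on:
  assumes "has_kth_derivative (Suc m) g h r s"
  shows "continuous_on (einterval r s) g"
proof (cases m)
  case 0
  then show ?thesis using assms by (simp add: has_kth_derivative_def times_cont_differentiable_on_def)
next
  case (Suc n)
  have "g field_differentiable (at x)" if "x \<in> einterval r s" for x
    using assms that Suc unfolding has_kth_derivative_def times_cont_differentiable_on_def
    by (auto dest!: spec[of _ 0])
  then show ?thesis
    by (intro continuous_at_imp_continuous_on ballI field_differentiable_imp_continuous_at)
qed

text \<open>The sign makes the integral Taylor remainder at \<open>x\<close> of an expansion around \<open>z\<close> a single integral over
  the line for both \<open>x > z\<close> and \<open>x < z\<close>, so that one application of Fubini suffices.\<close>

definition taylor_kernel :: "nat \<Rightarrow> real \<Rightarrow> real \<Rightarrow> real \<Rightarrow> real" where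
  "taylor_kernel m z x y =
     (x - y) ^ m / fact m * (if z < y \<and> y < x then 1 else if x < y \<and> y < z then -1 else 0)"

text \<open>The kernel lives on \<open>y\<close> between \<open>z\<close> and \<open>x\<close>. The
  majorant is free of \<open>y\<close>, which gives a bound uniform in \<open>y\<close> after
  integrating over \<open>x\<close>.\<close>

lemma abs_taylor_kernel_le: "\<bar>taylor_kernel m z x y\<bar> \<le> \<bar>(z - x) ^ m / fact m\<bar>"
proof -
  have "\<bar>x - y\<bar> \<le> \<bar>z - x\<bar>" if "(z < y \<and> y < x) \<or> (x < y \<and> y < z)" using that by auto
  then show ?thesis
    by (auto simp: taylor_kernel_def abs_mult power_abs intro!: divide_right_mono power_mono)
qed

subsection \<open>Tails of integrals, polynomials and laws of random variables\<close>

lemma set_integral_vanishing: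
  fixes \<psi> :: "real \<Rightarrow> real"
  assumes \<psi>: "integrable lborel \<psi>" and B[measurable]: "\<And>n. B n \<in> sets borel"
    and out: "\<And>t. \<forall>\<^sub>F n in sequentially. t \<notin> B n"
  shows "(\<lambda>n. LBINT t:B n. \<psi> t) \<longlonglongrightarrow> 0"
proof -
  have [measurable]: "\<psi> \<in> borel_measurable lborel" using \<psi> by auto
  have "(\<lambda>n. \<integral>t. indicator (B n) t *\<^sub>R \<psi> t \<partial>lborel) \<longlonglongrightarrow> (\<integral>t. 0 \<partial>(lborel :: real measure))"
  proof (rule integral_dominated_convergence[where w = "\<lambda>t. \<bar>\<psi> t\<bar>"])
    show "AE t in lborel. (\<lambda>n. indicator (B n) t *\<^sub>R \<psi> t) \<longlonglongrightarrow> 0"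
    proof (rule AE_I2)
      fix t
      show "(\<lambda>n. indicator (B n) t *\<^sub>R \<psi> t) \<longlonglongrightarrow> 0"
        by (rule tendsto_eventually, rule eventually_mono[OF out[of t]]) auto
    qed
  qed (use \<psi> in \<open>auto split: split_indicator\<close>)
  then show ?thesis by (simp add: set_lebesgue_integral_def)
qed

lemma set_integral_tail_at_top:
  fixes \<psi> :: "real \<Rightarrow> real"
  assumes "integrable lborel \<psi>"
  shows "((\<lambda>y. LBINT t:{y<..}. \<psi> t) \<longlongrightarrow> 0) at_top"
proof (rule tendsto_at_topI_sequentially)
  fix X :: "nat \<Rightarrow> real" assume X: "filterlim X at_top sequentially"
  show "(\<lambda>n. LBINT t:{X n<..}. \<psi> t) \<longlonglongrightarrow> 0"
    by (rule set_integral_vanishing[OF assms])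
      (use X in \<open>auto simp: filterlim_at_top not_less\<close>)
qed

lemma set_integral_tail_at_bot:
  fixes \<psi> :: "real \<Rightarrow> real"
  assumes "integrable lborel \<psi>"
  shows "((\<lambda>y. LBINT t:{..y}. \<psi> t) \<longlongrightarrow> 0) at_bot"
proof (rule tendsto_at_botI_sequentially)
  fix X :: "nat \<Rightarrow> real" assume X: "filterlim X at_bot sequentially"
  show "(\<lambda>n. LBINT t:{..X n}. \<psi> t) \<longlonglongrightarrow> 0"
    by (rule set_integral_vanishing[OF assms])
      (use X in \<open>auto simp: filterlim_at_bot_dense not_le\<close>)
qed

lemma abs_power_le_one_plus:
  fixes t :: real
  assumes "i \<le> m"
  shows "\<bar>t\<bar> ^ i \<le> 1 + \<bar>t\<bar> ^ m"
proof (cases "\<bar>t\<bar> \<le> 1")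
  case True
  then have "\<bar>t\<bar> ^ i \<le> 1" by (simp add: power_le_one)
  then show ?thesis by (simp add: add_increasing2)
next
  case False
  then have "\<bar>t\<bar> ^ i \<le> \<bar>t\<bar> ^ m" using assms by (intro power_increasing) auto
  then show ?thesis by simp
qed

lemma poly_growth:
  fixes p :: "real poly"
  assumes "degree p \<le> m"
  obtains C where "C \<ge> 0" "\<And>t. \<bar>poly p t\<bar> \<le> C * (1 + \<bar>t\<bar> ^ m)"
proof
  show "(\<Sum>i\<le>degree p. \<bar>coeff p i\<bar>) \<ge> 0" by (simp add: sum_nonneg)
  fix t
  have "\<bar>poly p t\<bar> \<le> (\<Sum>i\<le>degree p. \<bar>coeff p i * t ^ i\<bar>)" by (simp add: poly_altdef sum_abs)
  also have "\<dots> \<le> (\<Sum>i\<le>degree p. \<bar>coeff p i\<bar> * (1 + \<bar>t\<bar> ^ m))"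
    using assms by (intro sum_mono) (auto simp: abs_mult power_abs intro!: mult_left_mono abs_power_le_one_plus)
  finally show "\<bar>poly p t\<bar> \<le> (\<Sum>i\<le>degree p. \<bar>coeff p i\<bar>) * (1 + \<bar>t\<bar> ^ m)" by (simp add: sum_distrib_right)
qed

text \<open>Two values of opposite sign would enclose a root. The sign is a constant factor so that
  it can leave an integral by linearity.\<close>

lemma poly_constant_sign:
  fixes p :: "real poly"
  assumes "is_interval I" "\<And>x. x \<in> I \<Longrightarrow> poly p x \<noteq> 0"
  shows "\<exists>\<sigma>. \<bar>\<sigma>\<bar> = 1 \<and> (\<forall>x\<in>I. \<bar>poly p x\<bar> = \<sigma> * poly p x)"
proof -
  have same: "poly p x * poly p y > 0" if "x \<in> I" "y \<in> I" "x < y" for x y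
  proof (rule ccontr)
    assume "\<not> poly p x * poly p y > 0"
    then have "poly p x * poly p y < 0" using assms(2) that by (simp add: not_less less_le)
    from poly_IVT[OF that(3) this] obtain \<xi> where "x < \<xi>" "\<xi> < y" "poly p \<xi> = 0" by blast
    then show False using assms that unfolding is_interval_1 by (metis less_imp_le)
  qed
  have same': "poly p x * poly p y > 0" if "x \<in> I" "y \<in> I" for x y
  proof (cases x y rule: linorder_cases)
    case equal
    then show ?thesis using assms(2)[OF that(1)] by (auto simp: zero_less_mult_iff linorder_neq_iff)
  qed (use same[of x y] same[of y x] that in \<open>auto simp: mult.commute\<close>)
  show ?thesis
  proof (cases "I = {}")
    case False
    then obtain x0 where x0: "x0 \<in> I" by blast
    have "\<bar>poly p x\<bar> = sgn (poly p x0) * poly p x" if "x \<in> I" for x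
      using same'[OF x0 that] by (auto simp: sgn_if abs_if zero_less_mult_iff)
    moreover have "\<bar>sgn (poly p x0)\<bar> = 1" using assms(2)[OF x0] by (simp add: sgn_if)
    ultimately show ?thesis by blast
  qed (auto intro: exI[of _ 1])
qed

text \<open>Measurability is asked only of the product with the indicator, since \<open>g\<close>
  and \<open>h\<close> are arbitrary outside the support.\<close>

lemma set_integral_distributed:
  fixes X :: "'a \<Rightarrow> real"
  assumes dens: "distributed M lborel X (\<lambda>x. ennreal (f x))" and f: "\<And>x. f x \<ge> 0"
    and A: "A \<in> sets borel" and u: "(\<lambda>x. indicator A x * u x) \<in> borel_measurable borel"
  shows "set_integrable M {\<omega>\<in>space M. X \<omega> \<in> A} (\<lambda>\<omega>. u (X \<omega>)) \<longleftrightarrow>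
      integrable lborel (\<lambda>x. f x * (indicator A x * u x))"
    and "(LINT \<omega>:{\<omega>\<in>space M. X \<omega> \<in> A}|M. u (X \<omega>)) = (\<integral>x. f x * (indicator A x * u x) \<partial>lborel :: real)"
proof -
  have eq: "indicator {\<omega>\<in>space M. X \<omega> \<in> A} \<omega> *\<^sub>R u (X \<omega>) = indicator A (X \<omega>) * u (X \<omega>)" if "\<omega> \<in> space M" for \<omega>
    using that by (simp split: split_indicator)
  have u': "(\<lambda>x. indicator A x * u x) \<in> borel_measurable lborel" using u by simp
  show "set_integrable M {\<omega>\<in>space M. X \<omega> \<in> A} (\<lambda>\<omega>. u (X \<omega>)) \<longleftrightarrow>
      integrable lborel (\<lambda>x. f x * (indicator A x * u x))"
    unfolding set_integrable_def distributed_integrable[OF dens u' f]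
    by (rule Bochner_Integration.integrable_cong[OF refl eq])
  show "(LINT \<omega>:{\<omega>\<in>space M. X \<omega> \<in> A}|M. u (X \<omega>)) = (\<integral>x. f x * (indicator A x * u x) \<partial>lborel)"
    unfolding set_lebesgue_integral_def distributed_integral[OF dens u' f]
    by (rule Bochner_Integration.integral_cong[OF refl eq])
qed

subsection \<open>Densities satisfying the Pearson identity\<close>

text \<open>The probability space is stripped off, leaving Lebesgue integrals of \<open>f\<close>,
  and q becomes a formal polynomial so that degrees can be counted. \<open>centered\<close>
  expresses that \<mu> is the mean.\<close>

locale pearson_density =
  fixes f :: "real \<Rightarrow> real" and Q :: "real poly" and \<mu> :: real and r s :: ereal
  assumes f_borel [measurable]: "f \<in> borel_measurable borel"
    and f_nonneg: "f x \<ge> 0"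
    and f_int: "integrable lborel f"
    and tf_int: "integrable lborel (\<lambda>t. t * f t)"
    and centered: "(\<integral>t. (\<mu> - t) * f t \<partial>lborel) = 0"
    and degree_Q: "degree Q \<le> 2"
    and pearson: "(LBINT t:{..x}. (\<mu> - t) * f t) = poly Q x * f x"
    and support: "einterval r s = {x. f x > 0}"
begin

abbreviation S :: "real set" where "S \<equiv> einterval r s"

lemma f_zero: "x \<notin> S \<Longrightarrow> f x = 0"
  using support f_nonneg[of x] by (auto simp: less_le)

lemma f_pos: "x \<in> S \<Longrightarrow> f x > 0"
  using support by auto

lemma poly_borel_measurable [measurable]: "poly p \<in> borel_measurable borel" for p :: "real poly"
  by (intro borel_measurable_continuous_onI continuous_intros)

lemma cent_int: "integrable lborel (\<lambda>t. (\<mu> - t) * f t)"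
  using Bochner_Integration.integrable_diff[OF integrable_mult_right[OF f_int, of \<mu>] tf_int]
  by (simp add: algebra_simps)

section \<open>Positivity and regularity from the tail integrals\<close>

definition H :: "real \<Rightarrow> real" where "H x = poly Q x * f x"

lemma H_lower: "H x = (LBINT t:{..x}. (\<mu> - t) * f t)"
  by (simp add: H_def pearson)

text \<open>By \<open>centered\<close> the two tails balance. This form gives positivity to the
  right of \<mu> and decay at plus infinity.\<close>

lemma H_upper: "H x = (LBINT t:{x<..}. (t - \<mu>) * f t)"
proof -
  have "0 = (\<integral>t. indicator {..x} t *\<^sub>R ((\<mu> - t) * f t) - indicator {x<..} t *\<^sub>R ((t - \<mu>) * f t) \<partial>lborel)"
    unfolding centered[symmetric]
    by (intro Bochner_Integration.integral_cong refl) (auto split: split_indicator simp: algebra_simps)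
  also have "\<dots> = (LBINT t:{..x}. (\<mu> - t) * f t) - (LBINT t:{x<..}. (t - \<mu>) * f t)"
    unfolding set_lebesgue_integral_def
  proof (rule Bochner_Integration.integral_diff)
    show "integrable lborel (\<lambda>t. indicator {..x} t *\<^sub>R ((\<mu> - t) * f t))"
      using integrable_mult_indicator[OF _ cent_int, of "{..x}"] by simp
    have "(\<lambda>t. indicator {x<..} t *\<^sub>R ((t - \<mu>) * f t)) = (\<lambda>t. - (indicator {x<..} t *\<^sub>R ((\<mu> - t) * f t)))"
      by (auto split: split_indicator simp: algebra_simps)
    then show "integrable lborel (\<lambda>t. indicator {x<..} t *\<^sub>R ((t - \<mu>) * f t))"
      using integrable_mult_indicator[OF _ cent_int, of "{x<..}"] by simp
  qed
  finally show ?thesis by (simp add: H_lower)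
qed

text \<open>Of the two tail integrals, use the one whose integrand is nonnegative: the lower for
  \<open>x \<le> \<mu>\<close>, the upper otherwise. It is strictly positive because
  \<open>f > 0\<close> near \<open>x\<close>.\<close>

lemma H_pos:
  assumes "x \<in> S"
  shows "H x > 0"
proof -
  obtain e where "e > 0" and e: "ball x e \<subseteq> S"
    using open_contains_ball[of S] assms open_einterval by blast
  have null: False if "AE t in lborel. t \<notin> {a<..<b}" "a < b" for a b :: real
  proof -
    have "{t \<in> space lborel. \<not> t \<notin> {a<..<b}} = {a<..<b}" by auto
    then have "emeasure lborel {a<..<b} = 0"
      using AE_iff_measurable[of "{a<..<b}" lborel "\<lambda>t. t \<notin> {a<..<b}"] that by simp
    with that show False by simp
  qed
  show ?thesis
  proof (cases "x \<le> \<mu>")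
    case True
    let ?\<phi> = "\<lambda>t. indicator {..x} t *\<^sub>R ((\<mu> - t) * f t)"
    have int: "integrable lborel ?\<phi>" using integrable_mult_indicator[OF _ cent_int, of "{..x}"] by simp
    have nn: "?\<phi> t \<ge> 0" for t using True f_nonneg by (auto split: split_indicator)
    have "(\<integral>t. ?\<phi> t \<partial>lborel) \<noteq> 0"
    proof
      assume "(\<integral>t. ?\<phi> t \<partial>lborel) = 0"
      then have "AE t in lborel. ?\<phi> t = 0" using integral_nonneg_eq_0_iff_AE[OF int] nn by simp
      \<comment> \<open>Strictly to the left of \<open>x\<close> the factor \<open>\<mu> - t\<close>
        is positive even if \<open>x = \<mu>\<close>.\<close>
      then have "AE t in lborel. t \<notin> {x - e<..<x}"
      proof eventually_elim
        case (elim t)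
        show ?case
        proof
          assume t: "t \<in> {x - e<..<x}"
          then have "f t > 0" using e by (intro f_pos) (auto simp: dist_real_def subset_iff)
          then show False using elim t True by simp
        qed
      qed
      with null[of "x - e" x] \<open>e > 0\<close> show False by simp
    qed
    moreover have "(\<integral>t. ?\<phi> t \<partial>lborel) \<ge> 0" using nn by simp
    ultimately show ?thesis by (simp add: H_lower set_lebesgue_integral_def)
  next
    case False
    let ?\<phi> = "\<lambda>t. indicator {x<..} t *\<^sub>R ((t - \<mu>) * f t)"
    have "?\<phi> = (\<lambda>t. - (indicator {x<..} t *\<^sub>R ((\<mu> - t) * f t)))"
      by (auto split: split_indicator simp: algebra_simps)
    then have int: "integrable lborel ?\<phi>" using integrable_mult_indicator[OF _ cent_int, of "{x<..}"] by simp
    have nn: "?\<phi> t \<ge> 0" for t using False f_nonneg by (auto split: split_indicator)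
    have "(\<integral>t. ?\<phi> t \<partial>lborel) \<noteq> 0"
    proof
      assume "(\<integral>t. ?\<phi> t \<partial>lborel) = 0"
      then have "AE t in lborel. ?\<phi> t = 0" using integral_nonneg_eq_0_iff_AE[OF int] nn by simp
      then have "AE t in lborel. t \<notin> {x<..<x + e}"
      proof eventually_elim
        case (elim t)
        show ?case
        proof
          assume t: "t \<in> {x<..<x + e}"
          then have "f t > 0" using e by (intro f_pos) (auto simp: dist_real_def subset_iff)
          then show False using elim t False by simp
        qed
      qed
      with null[of x "x + e"] \<open>e > 0\<close> show False by simp
    qed
    moreover have "(\<integral>t. ?\<phi> t \<partial>lborel) \<ge> 0" using nn by simp
    ultimately show ?thesis by (simp add: H_upper set_lebesgue_integral_def)
  qed
qed

lemma Q_pos: "x \<in> S \<Longrightarrow> poly Q x > 0"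
  using H_pos[of x] f_pos[of x] by (simp add: H_def zero_less_mult_iff)

text \<open>Dominated convergence, with no regularity of \<open>f\<close>. It holds at every real
  \<open>x\<close>, in particular at finite endpoints of the support, where \<open>f\<close> and
  thus \<open>H\<close> is 0.\<close>

lemma isCont_H: "isCont H x"
  unfolding continuous_at_sequentially
proof (intro allI impI)
  fix X :: "nat \<Rightarrow> real" assume X: "X \<longlonglongrightarrow> x"
  have "(\<lambda>n. \<integral>t. indicator {..X n} t *\<^sub>R ((\<mu> - t) * f t) \<partial>lborel) \<longlonglongrightarrow>
      (\<integral>t. indicator {..x} t *\<^sub>R ((\<mu> - t) * f t) \<partial>lborel)"
  proof (rule integral_dominated_convergence[where w = "\<lambda>t. \<bar>(\<mu> - t) * f t\<bar>"])
    have "AE t in lborel. t \<noteq> x" by (rule AE_lborel_singleton)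
    then show "AE t in lborel. (\<lambda>n. indicator {..X n} t *\<^sub>R ((\<mu> - t) * f t)) \<longlonglongrightarrow> indicator {..x} t *\<^sub>R ((\<mu> - t) * f t)"
    proof eventually_elim
      case (elim t)
      have "\<forall>\<^sub>F n in sequentially. indicator {..X n} t = (indicator {..x} t :: real)"
      proof (cases "t < x")
        case True
        show ?thesis
          by (rule eventually_mono[OF order_tendstoD(1)[OF X True]]) (use True in auto)
      next
        case False
        with elim have "x < t" by simp
        show ?thesis
          by (rule eventually_mono[OF order_tendstoD(2)[OF X \<open>x < t\<close>]]) (use \<open>x < t\<close> in auto)
      qed
      then show ?case by (intro tendsto_eventually) (auto elim: eventually_mono)
    qed
  qed (use cent_int integrable_abs[OF cent_int] in \<open>auto split: split_indicator simp: abs_mult\<close>)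
  then show "(H \<circ> X) \<longlonglongrightarrow> H x" by (simp add: o_def H_lower set_lebesgue_integral_def)
qed

text \<open>Regularity bootstraps: \<open>H\<close> is continuous as an integral, hence so is
  \<open>f = H / Q\<close> on the support, hence \<open>H\<close> is differentiable there, hence so
  is \<open>f\<close>.\<close>

lemma isCont_f:
  assumes "x \<in> S"
  shows "isCont f x"
proof -
  have c: "isCont (\<lambda>y. H y / poly Q y) x"
    using Q_pos[OF assms] by (intro continuous_intros isCont_H) auto
  have "eventually (\<lambda>y. y \<in> S) (nhds x)" using assms by (intro eventually_nhds_in_open) auto
  then have "\<forall>\<^sub>F y in nhds x. H y / poly Q y = f y"
  proof eventually_elim
    case (elim y)
    then show ?case using Q_pos[of y] by (simp add: H_def)
  qed
  from isCont_cong[OF this] c show ?thesis by simp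
qed

lemma DERIV_H:
  assumes "x \<in> S"
  shows "(H has_real_derivative (\<mu> - x) * f x) (at x)"
proof -
  obtain e where "e > 0" and e: "cball x e \<subseteq> S"
    using open_contains_cball[of S] assms open_einterval by blast
  define a b where "a = x - e" and "b = x + e"
  have ab: "{a..b} \<subseteq> S" "a < x" "x < b"
    using e \<open>e > 0\<close> by (auto simp: a_def b_def dist_real_def subset_iff)
  let ?\<phi> = "\<lambda>t. (\<mu> - t) * f t"
  have H_eq: "H y = (LBINT t:{..<a}. ?\<phi> t) + integral {a..y} ?\<phi>" if "y \<in> {a..b}" for y
  proof -
    have si: "set_integrable lborel A ?\<phi>" if "A \<in> sets borel" for A
      unfolding set_integrable_def using integrable_mult_indicator[OF _ cent_int, of A] that by simp
    have "{..y} = {..<a} \<union> {a..y}" using that by auto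
    then have "H y = (LBINT t:{..<a}. ?\<phi> t) + (LBINT t:{a..y}. ?\<phi> t)"
      unfolding H_lower by (simp only:) (rule set_integral_Un, auto intro!: si)
    then show ?thesis using set_borel_integral_eq_integral(2)[OF si[of "{a..y}"]] by simp
  qed
  have "continuous_on {a..b} ?\<phi>"
    using ab isCont_f by (intro continuous_intros continuous_at_imp_continuous_on) auto
  from integral_has_real_derivative[OF this, of x] ab
  have "((\<lambda>y. (LBINT t:{..<a}. ?\<phi> t) + integral {a..y} ?\<phi>) has_real_derivative ?\<phi> x) (at x within {a..b})"
    by (auto intro!: derivative_eq_intros)
  then have "((\<lambda>y. (LBINT t:{..<a}. ?\<phi> t) + integral {a..y} ?\<phi>) has_real_derivative ?\<phi> x) (at x)"
    using ab at_within_Icc_at[of a x b] by simp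
  then show ?thesis
    by (rule has_field_derivative_transform_within_open[of _ _ _ "{a<..<b}"]) (use ab H_eq in auto)
qed

lemma DERIV_f:
  assumes "x \<in> S"
  shows "(f has_real_derivative (\<mu> - x - poly (pderiv Q) x) * f x / poly Q x) (at x)"
proof -
  note Q = Q_pos[OF assms]
  have "((\<lambda>y. H y / poly Q y) has_real_derivative
      ((\<mu> - x) * f x * poly Q x - H x * poly (pderiv Q) x) / (poly Q x * poly Q x)) (at x)"
    using Q by (intro DERIV_divide DERIV_H poly_DERIV assms) auto
  also have "((\<mu> - x) * f x * poly Q x - H x * poly (pderiv Q) x) / (poly Q x * poly Q x) =
      (\<mu> - x - poly (pderiv Q) x) * f x / poly Q x"
    using Q by (simp add: H_def field_simps)
  finally show ?thesis
    by (rule has_field_derivative_transform_within_open[of _ _ _ S])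
      (use assms Q_pos in \<open>auto simp: H_def\<close>, metis less_irrefl)
qed

section \<open>The Rodrigues polynomials\<close>

text \<open>Since \<open>Q f' = (\<mu> - x - Q') f\<close> on the support, each derivative of \<open>Q ^ k f\<close> up to order \<open>k\<close>
  lowers the power of \<open>Q\<close> by one and leaves a polynomial factor; the recursion below is
  the product rule for that factor.\<close>

primrec rodp :: "nat \<Rightarrow> nat \<Rightarrow> real poly" where
  "rodp k 0 = 1"
| "rodp k (Suc j) = (smult (real k - real (Suc j)) (pderiv Q) + [:\<mu>, -1:]) * rodp k j + Q * pderiv (rodp k j)"

lemma degree_rodp: "degree (rodp k j) \<le> j"
proof (induction j)
  case (Suc j)
  let ?p = "rodp k j"
  have "degree (smult (real k - real (Suc j)) (pderiv Q) + [:\<mu>, -1:]) \<le> 1"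
    using degree_Q by (intro degree_add_le) (auto intro!: order.trans[OF degree_smult_le] simp: degree_pderiv)
  then have 1: "degree ((smult (real k - real (Suc j)) (pderiv Q) + [:\<mu>, -1:]) * ?p) \<le> Suc j"
    using degree_mult_le[of "smult (real k - real (Suc j)) (pderiv Q) + [:\<mu>, -1:]" ?p] Suc by linarith
  \<comment> \<open>Constant \<open>?p\<close> is separate: truncated subtraction would bound the
    degree by 2, too much for \<open>j = 0\<close>, while in fact the product is 0.\<close>
  have 2: "degree (Q * pderiv ?p) \<le> Suc j"
  proof (cases "degree ?p = 0")
    case True
    then have "pderiv ?p = 0" by (simp add: pderiv_eq_0_iff)
    then show ?thesis by simp
  next
    case False
    then show ?thesis
      using degree_mult_le[of Q "pderiv ?p"] Suc degree_Q by (simp add: degree_pderiv)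
  qed
  show ?case using degree_add_le[OF 1 2] by simp
qed simp

text \<open>For \<open>j \<le> k\<close> this is the \<open>j\<close>-th derivative of q^k f on the
  support. The closed form extends it by 0 to the whole line, measurably, where iterated
  \<open>deriv\<close> would be unclear at the endpoints.\<close>

definition F :: "nat \<Rightarrow> nat \<Rightarrow> real \<Rightarrow> real" where
  "F k j x = poly Q x ^ (k - j) * poly (rodp k j) x * f x"

text \<open>\<open>j < k\<close> leaves a factor \<open>Q\<close> to cancel the denominator of
  \<open>f'\<close>.\<close>

lemma DERIV_F:
  assumes "j < k" "x \<in> S"
  shows "(F k j has_real_derivative F k (Suc j) x) (at x)"
proof -
  define n where "n = k - Suc j"
  have n: "k - j = Suc n" "k - Suc j = n" "real k - real (Suc j) = real n" using assms by (auto simp: n_def)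
  note Q = Q_pos[OF assms(2)]
  let ?p = "rodp k j"
  have "((\<lambda>y. poly Q y ^ Suc n * poly ?p y * f y) has_real_derivative
      (real (Suc n) * poly Q x ^ n * poly (pderiv Q) x * poly ?p x + poly Q x ^ Suc n * poly (pderiv ?p) x) * f x
      + poly Q x ^ Suc n * poly ?p x * ((\<mu> - x - poly (pderiv Q) x) * f x / poly Q x)) (at x)"
    by (rule derivative_eq_intros poly_DERIV DERIV_f assms refl)+ (simp add: algebra_simps)
  also have "(real (Suc n) * poly Q x ^ n * poly (pderiv Q) x * poly ?p x + poly Q x ^ Suc n * poly (pderiv ?p) x) * f x
      + poly Q x ^ Suc n * poly ?p x * ((\<mu> - x - poly (pderiv Q) x) * f x / poly Q x)
      = F k (Suc j) x"
  proof -
    have 1: "poly Q x ^ Suc n * poly ?p x * ((\<mu> - x - poly (pderiv Q) x) * f x / poly Q x)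
        = poly Q x ^ n * poly ?p x * (\<mu> - x - poly (pderiv Q) x) * f x"
      using Q by simp
    have 2: "poly (rodp k (Suc j)) x =
        (real n * poly (pderiv Q) x + (\<mu> - x)) * poly ?p x + poly Q x * poly (pderiv ?p) x"
      by (simp add: n(3) del: of_nat_Suc)
    show ?thesis unfolding 1 F_def 2 n(2) by (simp add: algebra_simps)
  qed
  finally show ?thesis by (simp add: F_def[abs_def] n)
qed

lemma rodrigues_eq:
  assumes "x \<in> S"
  shows "rodrigues (poly Q) f k x = (-1) ^ k * poly (rodp k k) x"
proof -
  have "(deriv ^^ k) (F k 0) x = F k k x"
    using DERIV_F assms by (intro iterated_deriv_eq[where S = S and F = "F k" and k = k]) auto
  moreover have "F k 0 = (\<lambda>y. poly Q y ^ k * f y)" by (simp add: F_def[abs_def])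
  ultimately show ?thesis using f_pos[OF assms] by (simp add: rodrigues_def F_def)
qed

section \<open>Decay of polynomials times \<open>H\<close> at the ends of the support\<close>

lemma poly_f_integrable:
  assumes mom: "integrable lborel (\<lambda>t. \<bar>t\<bar> ^ m * f t)" and "degree p \<le> m"
  shows "integrable lborel (\<lambda>t. poly p t * f t)"
proof -
  obtain C where C: "C \<ge> 0" "\<And>t. \<bar>poly p t\<bar> \<le> C * (1 + \<bar>t\<bar> ^ m)" using poly_growth[OF assms(2)] by blast
  show ?thesis
  proof (rule Bochner_Integration.integrable_bound)
    show "integrable lborel (\<lambda>t. C * (f t + \<bar>t\<bar> ^ m * f t))"
      using f_int mom by simp
    have "\<bar>poly p t * f t\<bar> \<le> \<bar>C * (f t + \<bar>t\<bar> ^ m * f t)\<bar>" for t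
    proof -
      have "\<bar>poly p t * f t\<bar> \<le> C * (1 + \<bar>t\<bar> ^ m) * f t"
        using C(2)[of t] f_nonneg[of t] by (simp add: abs_mult mult_right_mono)
      then show ?thesis by (simp add: algebra_simps)
    qed
    then show "AE t in lborel. norm (poly p t * f t) \<le> norm (C * (f t + \<bar>t\<bar> ^ m * f t))" by simp
  qed measurable
qed

lemma moment_mono:
  assumes mom: "integrable lborel (\<lambda>t. \<bar>t\<bar> ^ m * f t)" and "i \<le> m"
  shows "integrable lborel (\<lambda>t. \<bar>t\<bar> ^ i * f t)"
proof -
  have "integrable lborel (\<lambda>t. \<bar>poly (monom 1 i) t * f t\<bar>)"
    using assms by (intro integrable_abs poly_f_integrable[OF mom]) (auto simp: degree_monom_eq)
  then show ?thesis using f_nonneg by (simp add: poly_monom abs_mult power_abs)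
qed

text \<open>Every \<open>t\<close> in the tail beyond \<open>y\<close> satisfies
  \<open>\<bar>y\<bar> \<le> \<bar>t\<bar>\<close>, so the growth bound for \<open>p\<close> at
  \<open>y\<close> may be moved under the integral defining \<open>H\<close> and evaluated at
  \<open>t\<close>. What results is the tail of a fixed integrable function \<open>\<psi>\<close>;
  its factor \<open>\<bar>t - \<mu>\<bar>\<close> is why the moment of order \<open>Suc m\<close> is
  assumed.\<close>

lemma poly_H_tails:
  assumes mom: "integrable lborel (\<lambda>t. \<bar>t\<bar> ^ Suc m * f t)" and "degree p \<le> m"
  shows "((\<lambda>y. poly p y * H y) \<longlongrightarrow> 0) at_top" "((\<lambda>y. poly p y * H y) \<longlongrightarrow> 0) at_bot"
proof -
  obtain C where C: "C \<ge> 0" "\<And>t. \<bar>poly p t\<bar> \<le> C * (1 + \<bar>t\<bar> ^ m)" using poly_growth[OF assms(2)] by blast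
  define \<psi> where "\<psi> t = C * (1 + \<bar>t\<bar> ^ m) * (\<bar>t - \<mu>\<bar> * f t)" for t
  have \<psi>_int: "integrable lborel \<psi>"
  proof (rule Bochner_Integration.integrable_bound)
    show "integrable lborel (\<lambda>t. C * (\<bar>t\<bar> ^ 1 * f t + \<bar>\<mu>\<bar> * f t + \<bar>t\<bar> ^ Suc m * f t + \<bar>\<mu>\<bar> * (\<bar>t\<bar> ^ m * f t)))"
      by (intro integrable_mult_right Bochner_Integration.integrable_add moment_mono[OF mom] f_int) auto
    show "\<psi> \<in> borel_measurable lborel" unfolding \<psi>_def by measurable
    have "\<bar>\<psi> t\<bar> \<le> \<bar>C * (\<bar>t\<bar> ^ 1 * f t + \<bar>\<mu>\<bar> * f t + \<bar>t\<bar> ^ Suc m * f t + \<bar>\<mu>\<bar> * (\<bar>t\<bar> ^ m * f t))\<bar>" for t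
    proof -
      have "\<bar>\<psi> t\<bar> = C * (1 + \<bar>t\<bar> ^ m) * (\<bar>t - \<mu>\<bar> * f t)"
        using C(1) f_nonneg by (simp add: \<psi>_def abs_mult)
      also have "\<dots> \<le> C * (1 + \<bar>t\<bar> ^ m) * ((\<bar>t\<bar> + \<bar>\<mu>\<bar>) * f t)"
        using C(1) f_nonneg by (intro mult_left_mono mult_right_mono) auto
      also have "\<dots> = C * (\<bar>t\<bar> ^ 1 * f t + \<bar>\<mu>\<bar> * f t + \<bar>t\<bar> ^ Suc m * f t + \<bar>\<mu>\<bar> * (\<bar>t\<bar> ^ m * f t))"
        by (simp add: algebra_simps)
      finally show ?thesis by linarith
    qed
    then show "AE t in lborel. norm (\<psi> t) \<le> norm (C * (\<bar>t\<bar> ^ 1 * f t + \<bar>\<mu>\<bar> * f t + \<bar>t\<bar> ^ Suc m * f t + \<bar>\<mu>\<bar> * (\<bar>t\<bar> ^ m * f t)))"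
      by simp
  qed
  have si: "set_integrable lborel A \<psi>" "set_integrable lborel A (\<lambda>t. c * \<bar>(\<mu> - t) * f t\<bar>)"
    if "A \<in> sets borel" for A c
    unfolding set_integrable_def using integrable_mult_indicator[OF _ \<psi>_int, of A]
      integrable_mult_indicator[OF _ integrable_mult_right[OF integrable_abs[OF cent_int], of c], of A] that by simp_all
  have abs_H: "\<bar>poly p y * H y\<bar> \<le> (LBINT t:A. \<psi> t)"
    if "\<bar>H y\<bar> \<le> (LBINT t:A. \<bar>(\<mu> - t) * f t\<bar>)" "A \<in> sets borel" "\<And>t. t \<in> A \<Longrightarrow> \<bar>y\<bar> \<le> \<bar>t\<bar>" for y A
  proof -
    have "\<bar>poly p y * H y\<bar> \<le> (C * (1 + \<bar>y\<bar> ^ m)) * (LBINT t:A. \<bar>(\<mu> - t) * f t\<bar>)"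
      unfolding abs_mult[of "poly p y"] using C that(1) by (intro mult_mono) auto
    also have "\<dots> = (LBINT t:A. (C * (1 + \<bar>y\<bar> ^ m)) * \<bar>(\<mu> - t) * f t\<bar>)" by simp
    also have "\<dots> \<le> (LBINT t:A. \<psi> t)"
    proof (rule set_integral_mono)
      fix t assume "t \<in> A"
      have "C * (1 + \<bar>y\<bar> ^ m) * \<bar>(\<mu> - t) * f t\<bar> \<le> C * (1 + \<bar>t\<bar> ^ m) * \<bar>(\<mu> - t) * f t\<bar>"
        using that(3)[OF \<open>t \<in> A\<close>] C(1) by (intro mult_right_mono mult_left_mono add_left_mono power_mono) auto
      then show "C * (1 + \<bar>y\<bar> ^ m) * \<bar>(\<mu> - t) * f t\<bar> \<le> \<psi> t"
        using f_nonneg by (simp add: \<psi>_def abs_mult abs_minus_commute)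
    qed (use si that(2) in auto)
    finally show ?thesis .
  qed
  show "((\<lambda>y. poly p y * H y) \<longlongrightarrow> 0) at_top"
  proof (rule Lim_null_comparison)
    show "\<forall>\<^sub>F y in at_top. norm (poly p y * H y) \<le> (LBINT t:{y<..}. \<psi> t)"
    proof (rule eventually_mono[OF eventually_ge_at_top[of "0 :: real"]])
      fix y :: real assume "0 \<le> y"
      have "\<bar>H y\<bar> \<le> (LBINT t:{y<..}. \<bar>(\<mu> - t) * f t\<bar>)"
        unfolding H_upper set_lebesgue_integral_def
        by (rule order_trans[OF integral_abs_bound])
          (auto intro!: eq_refl Bochner_Integration.integral_cong split: split_indicator simp: abs_mult abs_minus_commute)
      then show "norm (poly p y * H y) \<le> (LBINT t:{y<..}. \<psi> t)"
        using \<open>0 \<le> y\<close> abs_H[of y "{y<..}"] by auto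
    qed
  qed (rule set_integral_tail_at_top[OF \<psi>_int])
  show "((\<lambda>y. poly p y * H y) \<longlongrightarrow> 0) at_bot"
  proof (rule Lim_null_comparison)
    show "\<forall>\<^sub>F y in at_bot. norm (poly p y * H y) \<le> (LBINT t:{..y}. \<psi> t)"
    proof (rule eventually_mono[OF eventually_le_at_bot[of "0 :: real"]])
      fix y :: real assume "y \<le> 0"
      have "\<bar>H y\<bar> \<le> (LBINT t:{..y}. \<bar>(\<mu> - t) * f t\<bar>)"
        unfolding H_lower set_lebesgue_integral_def
        by (rule order_trans[OF integral_abs_bound])
          (auto intro!: eq_refl Bochner_Integration.integral_cong split: split_indicator simp: abs_mult)
      then show "norm (poly p y * H y) \<le> (LBINT t:{..y}. \<psi> t)"
        using \<open>y \<le> 0\<close> abs_H[of y "{..y}"] by auto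
    qed
  qed (rule set_integral_tail_at_bot[OF \<psi>_int])
qed

lemma poly_H_endpoint:
  assumes "f b = 0"
  shows "((\<lambda>y. poly p y * H y) \<longlongrightarrow> 0) (at b within A)"
proof -
  have "isCont (\<lambda>y. poly p y * H y) b" by (intro continuous_intros isCont_H)
  then have "((\<lambda>y. poly p y * H y) \<longlongrightarrow> poly p b * H b) (at b)" by (simp add: isCont_def)
  then show ?thesis using assms by (auto simp: H_def intro: tendsto_within_subset)
qed

text \<open>Finite and infinite ends are merged into the form of boundary limit that the fundamental
  theorem for extended real endpoints expects.\<close>

lemma poly_H_limits:
  assumes mom: "integrable lborel (\<lambda>t. \<bar>t\<bar> ^ Suc m * f t)" and "degree p \<le> m" and "r < s"
  shows "(((\<lambda>y. poly p y * H y) \<circ> real_of_ereal) \<longlongrightarrow> 0) (at_left s)"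
    and "(((\<lambda>y. poly p y * H y) \<circ> real_of_ereal) \<longlongrightarrow> 0) (at_right r)"
proof -
  have f0: "f b = 0" if "s = ereal b \<or> r = ereal b" for b
    using that by (intro f_zero) (auto simp: einterval_iff)
  show "(((\<lambda>y. poly p y * H y) \<circ> real_of_ereal) \<longlongrightarrow> 0) (at_left s)"
    using poly_H_tails[OF assms(1,2)] poly_H_endpoint f0 \<open>r < s\<close>
    by (cases s) (auto simp: ereal_tendsto_simps)
  show "(((\<lambda>y. poly p y * H y) \<circ> real_of_ereal) \<longlongrightarrow> 0) (at_right r)"
    using poly_H_tails[OF assms(1,2)] poly_H_endpoint f0 \<open>r < s\<close>
    by (cases r) (auto simp: ereal_tendsto_simps)
qed

subsection \<open>Inversion of the Rodrigues formula\<close>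

lemma F_zero: "y \<notin> S \<Longrightarrow> F k j y = 0"
  by (simp add: F_def f_zero)

lemma F_borel_measurable [measurable]: "F k j \<in> borel_measurable borel"
  unfolding F_def by measurable

lemma F_0_pos: "y \<in> S \<Longrightarrow> F k 0 y > 0"
  by (simp add: F_def Q_pos f_pos)

text \<open>Repeated integration by parts in closed form: \<open>\<Phi> k m x\<close> is an antiderivative of
  \<open>F k k y * (x - y) ^ m / fact m\<close>, and it vanishes at both ends of the support because each
  summand is a polynomial times \<open>H\<close>.\<close>

definition \<Phi> :: "nat \<Rightarrow> nat \<Rightarrow> real \<Rightarrow> real \<Rightarrow> real" where
  "\<Phi> k m x y = (\<Sum>i\<le>m. F k (k - Suc m + i) y * ((x - y) ^ i / fact i))"

text \<open>At \<open>y = x\<close> only \<open>i = 0\<close> survives, and for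
  \<open>k = Suc m\<close> its derivative index is 0.\<close>

lemma \<Phi>_diag: "\<Phi> (Suc m) m x x = F (Suc m) 0 x"
  using Taylor_sum_diag[of "\<lambda>i. F (Suc m) i x" x m] by (simp add: \<Phi>_def)

lemma DERIV_\<Phi>:
  assumes "m < k" "y \<in> S"
  shows "(\<Phi> k m x has_real_derivative F k k y * ((x - y) ^ m / fact m)) (at y)"
proof -
  have *: "k = Suc (k - Suc m + m)" using assms by simp
  have "(F k (k - Suc m + i) has_real_derivative F k (k - Suc m + Suc i) y) (at y)" if "i < m" for i
    using DERIV_F[of "k - Suc m + i" k y] that assms by simp
  moreover have "(F k (k - Suc m + m) has_real_derivative F k k y) (at y)"
    using DERIV_F[of "k - Suc m + m" k y] * assms by simp
  ultimately show ?thesis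
    unfolding \<Phi>_def[abs_def] by (rule DERIV_Taylor_telescope)
qed

lemma \<Phi>_limits:
  assumes mom: "integrable lborel (\<lambda>t. \<bar>t\<bar> ^ (2 * k - 1) * f t)" and "m < k" and "r < s"
  shows "((\<Phi> k m x \<circ> real_of_ereal) \<longlongrightarrow> 0) (at_left s)"
    and "((\<Phi> k m x \<circ> real_of_ereal) \<longlongrightarrow> 0) (at_right r)"
proof -
  \<comment> \<open>One factor \<open>Q\<close> is moved from the power into
    \<open>H\<close>.\<close>
  define p where "p i = smult (1 / fact i) (Q ^ (m - i) * rodp k (k - Suc m + i) * [:x, -1:] ^ i)" for i
  have p: "F k (k - Suc m + i) y * ((x - y) ^ i / fact i) = poly (p i) y * H y" if "i \<le> m" for i y
  proof -
    have "k - (k - Suc m + i) = Suc (m - i)" using that \<open>m < k\<close> by simp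
    then show ?thesis unfolding F_def p_def H_def by (simp only:) (simp add: poly_power)
  qed
  have deg: "degree (p i) \<le> 2 * k - 2" if "i \<le> m" for i
  proof -
    have "degree (Q ^ (m - i)) \<le> 2 * (m - i)"
      using degree_power_le[of Q "m - i"] degree_Q by (meson le_trans mult_le_mono1)
    moreover have "degree ([:x, -1:] ^ i) \<le> i"
      using degree_power_le[of "[:x, -1:]" i] by simp
    ultimately have "degree (Q ^ (m - i) * rodp k (k - Suc m + i) * [:x, -1:] ^ i)
        \<le> 2 * (m - i) + (k - Suc m + i) + i"
      by (intro order.trans[OF degree_mult_le] add_mono degree_rodp)
    \<comment> \<open>The sum equals \<open>m + k - 1\<close>, so the extreme case is
      \<open>m = k - 1\<close>.\<close>
    also have "\<dots> \<le> 2 * k - 2" using that \<open>m < k\<close> by simp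
    finally show ?thesis using degree_smult_le order_trans unfolding p_def by blast
  qed
  have eq: "\<Phi> k m x \<circ> real_of_ereal = (\<lambda>y. \<Sum>i\<le>m. ((\<lambda>y. poly (p i) y * H y) \<circ> real_of_ereal) y)"
    by (rule ext) (auto simp only: \<Phi>_def p o_def atMost_iff intro!: sum.cong)
  have mom': "integrable lborel (\<lambda>t. \<bar>t\<bar> ^ Suc (2 * k - 2) * f t)"
  proof -
    have "Suc (2 * k - 2) = 2 * k - 1" using \<open>m < k\<close> by simp
    then show ?thesis using mom by (simp only:)
  qed
  show "((\<Phi> k m x \<circ> real_of_ereal) \<longlongrightarrow> 0) (at_left s)"
    unfolding eq by (intro tendsto_null_sum poly_H_limits(1)[OF mom' deg \<open>r < s\<close>]) auto
  show "((\<Phi> k m x \<circ> real_of_ereal) \<longlongrightarrow> 0) (at_right r)"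
    unfolding eq by (intro tendsto_null_sum poly_H_limits(2)[OF mom' deg \<open>r < s\<close>]) auto
qed

lemma F_power_integrable:
  assumes mom: "integrable lborel (\<lambda>t. \<bar>t\<bar> ^ (2 * k - 1) * f t)" and "m < k"
  shows "integrable lborel (\<lambda>y. F k k y * ((x - y) ^ m / fact m))"
proof -
  have "degree ([:x, -1:] ^ m) \<le> m"
    using degree_power_le[of "[:x, -1:]" m] by simp
  then have "degree (rodp k k * [:x, -1:] ^ m) \<le> k + m"
    by (intro order.trans[OF degree_mult_le] add_mono degree_rodp)
  also have "\<dots> \<le> 2 * k - 1" using \<open>m < k\<close> by simp
  finally have "integrable lborel (\<lambda>y. (1 / fact m) * (poly (rodp k k * [:x, -1:] ^ m) y * f y))"
    by (intro integrable_mult_right poly_f_integrable[OF mom])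
  then show ?thesis by (simp add: F_def poly_power mult_ac)
qed

lemma F_power_interval_integral:
  assumes mom: "integrable lborel (\<lambda>t. \<bar>t\<bar> ^ (2 * k - 1) * f t)" and "m < k" and "a < b"
    and ab: "einterval a b \<subseteq> S"
    and A: "((\<Phi> k m x \<circ> real_of_ereal) \<longlongrightarrow> A) (at_right a)"
    and B: "((\<Phi> k m x \<circ> real_of_ereal) \<longlongrightarrow> B) (at_left b)"
  shows "(LBINT y=a..b. F k k y * ((x - y) ^ m / fact m)) = B - A"
proof (rule interval_integral_FTC_integrable[OF \<open>a < b\<close> _ _ _ A B])
  show "set_integrable lborel (einterval a b) (\<lambda>y. F k k y * ((x - y) ^ m / fact m))"
    unfolding set_integrable_def
    using integrable_mult_indicator[OF _ F_power_integrable[OF assms(1,2)], of "einterval a b"] by simp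
next
  fix y assume "a < ereal y" "ereal y < b"
  then have y: "y \<in> S" using ab by (auto simp: einterval_iff)
  then show "(\<Phi> k m x has_vector_derivative F k k y * ((x - y) ^ m / fact m)) (at y)"
    using DERIV_\<Phi>[OF \<open>m < k\<close>] by (simp add: has_real_derivative_iff_has_vector_derivative)
  show "isCont (\<lambda>y. F k k y * ((x - y) ^ m / fact m)) y"
    unfolding F_def by (intro continuous_intros isCont_f y) auto
qed

lemma isCont_\<Phi>: "m < k \<Longrightarrow> z \<in> S \<Longrightarrow> isCont (\<Phi> k m x) z"
  using DERIV_\<Phi> DERIV_isCont by blast

text \<open>Since \<Phi> vanishes at both ends, only the value at the splitting point
  \<open>z\<close> remains, and nothing at all on the whole line. The centre \<open>x\<close> is
  independent of \<open>z\<close>: (a) takes \<open>x = z\<close>, orthogonality to powers allows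
  any centre.\<close>

lemma F_power_integrals:
  assumes mom: "integrable lborel (\<lambda>t. \<bar>t\<bar> ^ (2 * k - 1) * f t)" and "m < k" and z: "z \<in> S"
  shows "(LBINT y=r..ereal z. F k k y * ((x - y) ^ m / fact m)) = \<Phi> k m x z"
    and "(LBINT y=ereal z..s. F k k y * ((x - y) ^ m / fact m)) = - \<Phi> k m x z"
    and "(\<integral>y. F k k y * ((x - y) ^ m / fact m) \<partial>lborel) = 0"
proof -
  have rz: "r < ereal z" "ereal z < s" using z by (auto simp: einterval_iff)
  then have "r < s" by simp
  have sub: "einterval r (ereal z) \<subseteq> S" "einterval (ereal z) s \<subseteq> S"
    using less_trans[OF _ rz(2), of "ereal _"] less_trans[OF rz(1), of "ereal _"]
    by (auto simp: einterval_iff)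
  note lim = \<Phi>_limits[OF assms(1,2) \<open>r < s\<close>]
  have c: "(\<Phi> k m x \<longlongrightarrow> \<Phi> k m x z) (at z within A)" for A
    using isCont_\<Phi>[OF \<open>m < k\<close> z] tendsto_within_subset unfolding isCont_def by blast
  show "(LBINT y=r..ereal z. F k k y * ((x - y) ^ m / fact m)) = \<Phi> k m x z"
    using F_power_interval_integral[OF assms(1,2) rz(1) sub(1) lim(2), of x "\<Phi> k m x z"] c
    by (simp add: ereal_tendsto_simps)
  show "(LBINT y=ereal z..s. F k k y * ((x - y) ^ m / fact m)) = - \<Phi> k m x z"
    using F_power_interval_integral[OF assms(1,2) rz(2) sub(2) _ lim(1), of x "\<Phi> k m x z"] c
    by (simp add: ereal_tendsto_simps)
  have "(LBINT y=r..s. F k k y * ((x - y) ^ m / fact m)) = 0"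
    using F_power_interval_integral[OF assms(1,2) \<open>r < s\<close> order.refl lim(2,1)] by simp
  moreover have "(LBINT y=r..s. F k k y * ((x - y) ^ m / fact m)) = (\<integral>y. F k k y * ((x - y) ^ m / fact m) \<partial>lborel)"
    using \<open>r < s\<close> unfolding interval_lebesgue_integral_def set_lebesgue_integral_def
    by (auto intro!: Bochner_Integration.integral_cong split: split_indicator simp: F_zero)
  ultimately show "(\<integral>y. F k k y * ((x - y) ^ m / fact m) \<partial>lborel) = 0" by simp
qed

lemma rodrigues_f:
  assumes "y \<in> S"
  shows "rodrigues (poly Q) f k y * f y = (-1) ^ k * F k k y"
  by (simp add: rodrigues_eq[OF assms] F_def)

theorem rodrigues_integral_representation:
  assumes mom: "integrable lborel (\<lambda>t. \<bar>t\<bar> ^ (2 * Suc m - 1) * f t)" and x: "x \<in> S"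
  defines "R \<equiv> rodrigues (poly Q) f (Suc m)"
  shows "interval_lebesgue_integrable lborel r (ereal x) (\<lambda>y. (x - y) ^ m * R y * f y)"
    and "poly Q x ^ Suc m * f x = (-1) ^ Suc m / fact m * (LBINT y=r..ereal x. (x - y) ^ m * R y * f y)"
    and "interval_lebesgue_integrable lborel (ereal x) s (\<lambda>y. (y - x) ^ m * R y * f y)"
    and "poly Q x ^ Suc m * f x = 1 / fact m * (LBINT y=ereal x..s. (y - x) ^ m * R y * f y)"
proof -
  let ?w = "\<lambda>y. F (Suc m) (Suc m) y * ((x - y) ^ m / fact m)"
  have rx: "r < ereal x" "ereal x < s" using x by (auto simp: einterval_iff)
  have sub: "y \<in> S" if "y \<in> einterval r (ereal x) \<or> y \<in> einterval (ereal x) s" for y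
    using that less_trans[OF _ rx(2), of "ereal y"] less_trans[OF rx(1), of "ereal y"]
    by (auto simp: einterval_iff)
  have w: "set_integrable lborel A (\<lambda>y. c * ?w y)" if "A \<in> sets borel" for A c
    unfolding set_integrable_def
    using integrable_mult_indicator[OF _ integrable_mult_right[OF F_power_integrable[OF mom lessI], of c], of A] that by simp
  have lower: "(x - y) ^ m * R y * f y = ((-1) ^ Suc m * fact m) * ?w y"
    if "y \<in> S" for y
    by (simp only: mult.assoc R_def rodrigues_f[OF that]) simp
  \<comment> \<open>The reflection sign \<open>(-1) ^ m\<close> and the Rodrigues sign combine to -1
    for every \<open>m\<close>, which the minus sign of the upper integral cancels.\<close>
  have upper: "(y - x) ^ m * R y * f y = (- fact m) * ?w y" if "y \<in> S" for y
  proof -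
    have "(y - x) ^ m = (-1) ^ m * (x - y) ^ m" by (simp flip: power_mult_distrib)
    then have "(y - x) ^ m * R y * f y = (-1) ^ m * ((x - y) ^ m * R y * f y)"
      by (simp only: mult.assoc)
    also have "\<dots> = ((-1) ^ m * (-1) ^ Suc m) * (fact m * ?w y)"
      unfolding lower[OF that] by (simp only: mult.assoc)
    also have "(-1) ^ m * (-1) ^ Suc m = (-1 :: real)" by (simp flip: power_add power_mult_distrib)
    finally show ?thesis by simp
  qed
  have F0: "\<Phi> (Suc m) m x x = poly Q x ^ Suc m * f x" by (simp add: \<Phi>_diag F_def)
  note I = F_power_integrals[OF mom lessI x, of x, unfolded F0]
  show "interval_lebesgue_integrable lborel r (ereal x) (\<lambda>y. (x - y) ^ m * R y * f y)"
  proof -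
    have "set_integrable lborel (einterval r (ereal x)) (\<lambda>y. (x - y) ^ m * R y * f y)"
      using w[of "einterval r (ereal x)" "(-1) ^ Suc m * fact m"] rx
      by (subst set_integrable_cong[OF refl refl lower]) (use sub in auto)
    then show ?thesis using rx by (simp add: interval_lebesgue_integrable_def less_imp_le)
  qed
  show "interval_lebesgue_integrable lborel (ereal x) s (\<lambda>y. (y - x) ^ m * R y * f y)"
  proof -
    have "set_integrable lborel (einterval (ereal x) s) (\<lambda>y. (y - x) ^ m * R y * f y)"
      using w[of "einterval (ereal x) s" "- fact m"] rx
      by (subst set_integrable_cong[OF refl refl upper]) (use sub in auto)
    then show ?thesis using rx by (simp add: interval_lebesgue_integrable_def less_imp_le)
  qed
  have "(LBINT y=r..ereal x. (x - y) ^ m * R y * f y) = (LBINT y=r..ereal x. ((-1) ^ Suc m * fact m) * ?w y)"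
    using rx by (intro interval_integral_cong lower sub) (simp add: min_def max_def less_imp_le)
  also have "\<dots> = ((-1) ^ Suc m * fact m) * (poly Q x ^ Suc m * f x)"
    by (subst interval_lebesgue_integral_mult_right) (simp only: I(1))
  finally show "poly Q x ^ Suc m * f x = (-1) ^ Suc m / fact m * (LBINT y=r..ereal x. (x - y) ^ m * R y * f y)"
    by (simp add: power_add[symmetric] mult.assoc[symmetric] flip: power_mult_distrib)
  have "(LBINT y=ereal x..s. (y - x) ^ m * R y * f y) = (LBINT y=ereal x..s. (- fact m) * ?w y)"
    using rx by (intro interval_integral_cong upper sub) (simp add: min_def max_def less_imp_le)
  also have "\<dots> = (- fact m) * (- (poly Q x ^ Suc m * f x))"
    by (subst interval_lebesgue_integral_mult_right) (simp only: I(2))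
  finally show "poly Q x ^ Suc m * f x = 1 / fact m * (LBINT y=ereal x..s. (y - x) ^ m * R y * f y)"
    by simp
qed

subsection \<open>Integration by parts against the Rodrigues polynomials\<close>

text \<open>For fixed \<open>y\<close> the kernel lives on the side of \<open>y\<close> away from
  \<open>z\<close>, so the integral over \<open>x\<close> is one of the two tail integrals centred
  at \<open>y\<close>. The sign built into the kernel makes both cases give the same value.\<close>

lemma F_kernel_integral:
  assumes mom: "integrable lborel (\<lambda>t. \<bar>t\<bar> ^ (2 * Suc m - 1) * f t)"
    and yz: "y \<in> S" "z \<in> S" "y \<noteq> z"
  shows "integrable lborel (\<lambda>x. F (Suc m) (Suc m) x * taylor_kernel m z x y)"
    and "(\<integral>x. F (Suc m) (Suc m) x * taylor_kernel m z x y \<partial>lborel) = (-1) ^ Suc m * F (Suc m) 0 y"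
proof -
  let ?w = "\<lambda>x. F (Suc m) (Suc m) x * ((y - x) ^ m / fact m)"
  have w: "integrable lborel ?w" by (rule F_power_integrable[OF mom lessI])
  have swap: "(x - y) ^ m = (-1) ^ m * (y - x) ^ m" for x by (simp flip: power_mult_distrib)
  have ys: "r < ereal y" "ereal y < s" using yz by (auto simp: einterval_iff)
  note I = F_power_integrals(1,2)[OF mom lessI yz(1), of y, unfolded \<Phi>_diag]
  have "integrable lborel (\<lambda>x. F (Suc m) (Suc m) x * taylor_kernel m z x y) \<and>
    (\<integral>x. F (Suc m) (Suc m) x * taylor_kernel m z x y \<partial>lborel) = (-1) ^ Suc m * F (Suc m) 0 y"
  proof (cases "z < y")
    case True
    have eq: "F (Suc m) (Suc m) x * taylor_kernel m z x y
        = (-1) ^ m * (indicator (einterval (ereal y) s) x *\<^sub>R ?w x)" for x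
    proof (cases "x \<in> S")
      case xS: True
      then have "x \<in> einterval (ereal y) s \<longleftrightarrow> y < x" by (auto simp: einterval_iff)
      then show ?thesis using True swap[of x] by (auto simp: taylor_kernel_def split: split_indicator)
    qed (simp add: F_zero)
    have J: "(\<integral>x. indicator (einterval (ereal y) s) x *\<^sub>R ?w x \<partial>lborel) = - F (Suc m) 0 y"
      using I(2) ys by (simp add: interval_lebesgue_integral_def set_lebesgue_integral_def less_imp_le del: times_divide_eq_right)
    have "integrable lborel (\<lambda>x. indicator (einterval (ereal y) s) x *\<^sub>R ?w x)"
      by (rule integrable_mult_indicator[OF _ w]) simp
    then show ?thesis
      unfolding eq integral_mult_right_zero J by (intro conjI integrable_mult_right) auto
  next
    case False
    with yz have "y < z" by simp
    have eq: "F (Suc m) (Suc m) x * taylor_kernel m z x y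
        = (-1) ^ Suc m * (indicator (einterval r (ereal y)) x *\<^sub>R ?w x)" for x
    proof (cases "x \<in> S")
      case xS: True
      then have "x \<in> einterval r (ereal y) \<longleftrightarrow> x < y" by (auto simp: einterval_iff)
      then show ?thesis using \<open>y < z\<close> swap[of x] by (auto simp: taylor_kernel_def split: split_indicator)
    qed (simp add: F_zero)
    have J: "(\<integral>x. indicator (einterval r (ereal y)) x *\<^sub>R ?w x \<partial>lborel) = F (Suc m) 0 y"
      using I(1) ys by (simp add: interval_lebesgue_integral_def set_lebesgue_integral_def less_imp_le del: times_divide_eq_right)
    have "integrable lborel (\<lambda>x. indicator (einterval r (ereal y)) x *\<^sub>R ?w x)"
      by (rule integrable_mult_indicator[OF _ w]) simp
    then show ?thesis
      unfolding eq integral_mult_right_zero J by (intro conjI integrable_mult_right) auto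
  qed
  then show "integrable lborel (\<lambda>x. F (Suc m) (Suc m) x * taylor_kernel m z x y)"
    and "(\<integral>x. F (Suc m) (Suc m) x * taylor_kernel m z x y \<partial>lborel) = (-1) ^ Suc m * F (Suc m) 0 y"
    by auto
qed

lemma is_interval_S: "is_interval S"
  unfolding is_interval_1
proof (intro ballI allI impI)
  fix a b x assume "a \<in> S" "b \<in> S" "a \<le> x \<and> x \<le> b"
  then show "x \<in> S"
    using less_le_trans[of r "ereal a" "ereal x"] le_less_trans[of "ereal x" "ereal b" s]
    by (simp add: einterval_iff)
qed

lemma Icc_subset_S: "a \<in> S \<Longrightarrow> b \<in> S \<Longrightarrow> {a..b} \<subseteq> S"
  using mem_is_interval_1_I[OF is_interval_S] by (meson atLeastAtMost_iff subsetI)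

lemma F_continuous_on: "A \<subseteq> S \<Longrightarrow> continuous_on A (F k j)"
  unfolding F_def
  by (intro continuous_intros continuous_at_imp_continuous_on) (use isCont_f in auto)

text \<open>Near the ends of the support the polynomial \<open>rodp k k\<close> has constant sign, so the absolute value
  can be pulled out of \<open>F_kernel_integral\<close>; the remaining \<open>y\<close> lie in a compact interval, on which
  \<open>F k 0\<close> is bounded away from zero.\<close>

lemma F_kernel_bound:
  assumes mom: "integrable lborel (\<lambda>t. \<bar>t\<bar> ^ (2 * Suc m - 1) * f t)" and z: "z \<in> S"
  shows "\<exists>C. \<forall>y\<in>S. y \<noteq> z \<longrightarrow>
    (\<integral>x. \<bar>F (Suc m) (Suc m) x * taylor_kernel m z x y\<bar> \<partial>lborel) \<le> C * F (Suc m) 0 y"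
proof (cases "rodp (Suc m) (Suc m) = 0")
  \<comment> \<open>The zero polynomial has no finite root set, but here the integrand
    vanishes.\<close>
  case True
  then have "F (Suc m) (Suc m) x = 0" for x by (simp add: F_def del: rodp.simps)
  then show ?thesis by (auto intro!: exI[of _ 0])
next
  case False
  let ?p = "rodp (Suc m) (Suc m)"
  let ?F = "F (Suc m) (Suc m)" and ?G = "F (Suc m) 0" and ?K = "taylor_kernel m z"
  \<comment> \<open>Once the sign is constant in \<open>x\<close>, the absolute integral is the
    exact integral up to sign, with no loss.\<close>
  have signed: "(\<integral>x. \<bar>?F x * ?K x y\<bar> \<partial>lborel) \<le> ?G y"
    if "y \<in> S" "y \<noteq> z" "\<bar>\<tau>\<bar> = 1" "\<And>x. \<bar>?F x * ?K x y\<bar> = \<tau> * (?F x * ?K x y)" for y \<tau>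
  proof -
    have "(\<integral>x. \<bar>?F x * ?K x y\<bar> \<partial>lborel) = \<tau> * ((-1) ^ Suc m * ?G y)"
      using F_kernel_integral(2)[OF mom that(1) z that(2)] by (simp only: that(4) integral_mult_right_zero)
    also have "\<dots> \<le> \<bar>\<tau> * ((-1) ^ Suc m * ?G y)\<bar>" by simp
    also have "\<dots> = ?G y" using that(3) F_0_pos[OF that(1), of "Suc m"] by (simp add: abs_mult power_abs)
    finally show ?thesis .
  qed
  define D where "D = (\<integral>x. \<bar>?F x * ((z - x) ^ m / fact m)\<bar> \<partial>lborel)"
  have D0: "D \<ge> 0" by (simp add: D_def)
  have crude: "(\<integral>x. \<bar>?F x * ?K x y\<bar> \<partial>lborel) \<le> D" for y
    unfolding D_def
  proof (rule integral_mono')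
    show "integrable lborel (\<lambda>x. \<bar>?F x * ((z - x) ^ m / fact m)\<bar>)"
      by (intro integrable_abs F_power_integrable[OF mom lessI])
    show "\<bar>?F x * ?K x y\<bar> \<le> \<bar>?F x * ((z - x) ^ m / fact m)\<bar>" for x
      unfolding abs_mult[of "?F x"] by (intro mult_left_mono abs_taylor_kernel_le) auto
  qed auto
  \<comment> \<open>Including \<open>z\<close> makes the set nonempty and ensures that
    \<open>y\<close> outside \<open>{a..b}\<close> lies on a known side of \<open>z\<close>, which
    fixes the branch of the kernel.\<close>
  define Z where "Z = insert z ({x. poly ?p x = 0} \<inter> S)"
  have Z: "finite Z" "Z \<noteq> {}" "Z \<subseteq> S" "z \<in> Z" using poly_roots_finite[OF False] z by (auto simp: Z_def)
  define a b where "a = Min Z" and "b = Max Z"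
  have ab: "a \<in> S" "b \<in> S" "a \<le> z" "z \<le> b"
    unfolding a_def b_def
    using Z(3) Min_in[OF Z(1,2)] Max_in[OF Z(1,2)] Min_le[OF Z(1,4)] Max_ge[OF Z(1,4)] by blast+
  have roots: "a \<le> x \<and> x \<le> b" if "x \<in> S" "poly ?p x = 0" for x
    using that Z(1) by (simp add: a_def b_def Z_def)
  have "continuous_on {a..b} (\<lambda>y. 1 / ?G y)"
    using Icc_subset_S[OF ab(1,2)] F_0_pos by (intro continuous_intros F_continuous_on) (auto simp: less_le subset_iff)
  then obtain A where A: "A \<ge> 0" "\<And>y. y \<in> {a..b} \<Longrightarrow> \<bar>1 / ?G y\<bar> \<le> A" by (rule bounded_on_Icc) (rule that)
  \<comment> \<open>1 serves the two ends, \<open>D * A\<close> the compact middle.\<close>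
  define C where "C = max 1 (D * A)"
  have "(\<integral>x. \<bar>?F x * ?K x y\<bar> \<partial>lborel) \<le> C * ?G y" if y: "y \<in> S" "y \<noteq> z" for y
  proof -
    note F0 = F_0_pos[OF y(1), of "Suc m"]
    have CG: "?G y \<le> C * ?G y" using F0 mult_right_mono[of 1 C "?G y"] by (simp add: C_def)
    consider "y \<in> {a..b}" | "y > b" | "y < a" by fastforce
    then show ?thesis
    proof cases
      case 1
      have "1 \<le> A * ?G y" using A(2)[OF 1] F0 by (simp add: field_simps)
      then have "D * 1 \<le> D * (A * ?G y)" using D0 by (rule mult_left_mono)
      also have "\<dots> \<le> C * ?G y" using F0 unfolding mult.assoc[symmetric]
        by (intro mult_right_mono) (auto simp: C_def)
      finally show ?thesis using crude[of y] by simp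
    next
      case 2
      have "is_interval (S \<inter> {b<..})" by (intro is_interval_Int is_interval_S is_interval_oi)
      then obtain \<sigma> where \<sigma>: "\<bar>\<sigma>\<bar> = 1" "\<And>x. x \<in> S \<Longrightarrow> b < x \<Longrightarrow> \<bar>poly ?p x\<bar> = \<sigma> * poly ?p x"
        using poly_constant_sign[of "S \<inter> {b<..}" ?p] roots by fastforce
      have "\<bar>?F x * ?K x y\<bar> = \<sigma> * (?F x * ?K x y)" for x
      proof (cases "x \<in> S \<and> y < x")
        case True
        then have "\<bar>?K x y\<bar> = ?K x y" by (auto simp: taylor_kernel_def)
        then show ?thesis using True 2 \<sigma>(2)[of x] f_nonneg[of x]
          by (simp add: F_def abs_mult del: rodp.simps)
      next
        case False
        then show ?thesis using 2 ab by (auto simp: F_zero taylor_kernel_def)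
      qed
      from signed[OF y \<sigma>(1) this] show ?thesis using CG by (rule order_trans)
    next
      case 3
      have "is_interval (S \<inter> {..<a})" by (intro is_interval_Int is_interval_S is_interval_io)
      then obtain \<sigma> where \<sigma>: "\<bar>\<sigma>\<bar> = 1" "\<And>x. x \<in> S \<Longrightarrow> x < a \<Longrightarrow> \<bar>poly ?p x\<bar> = \<sigma> * poly ?p x"
        using poly_constant_sign[of "S \<inter> {..<a}" ?p] roots by fastforce
      \<comment> \<open>For \<open>x < y < z\<close> the power contributes \<open>(-1) ^ m\<close>
        and the kernel one more minus sign.\<close>
      define \<tau> where "\<tau> = (-1) ^ Suc m * \<sigma>"
      have "\<bar>\<tau>\<bar> = 1" using \<sigma>(1) by (simp add: \<tau>_def abs_mult power_abs)
      have "\<bar>?F x * ?K x y\<bar> = \<tau> * (?F x * ?K x y)" for x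
      proof (cases "x \<in> S \<and> x < y")
        case True
        have "\<bar>x - y\<bar> ^ m = (-1) ^ m * (x - y) ^ m" using True by (simp flip: power_mult_distrib)
        then have "\<bar>?K x y\<bar> = (-1) ^ Suc m * ?K x y" using True 3 ab
          by (auto simp: taylor_kernel_def abs_mult power_abs)
        then show ?thesis using True 3 \<sigma>(2)[of x] f_nonneg[of x]
          by (simp add: F_def abs_mult \<tau>_def del: rodp.simps)
      next
        case False
        then show ?thesis using 3 ab by (auto simp: F_zero taylor_kernel_def)
      qed
      from signed[OF y \<open>\<bar>\<tau>\<bar> = 1\<close> this] show ?thesis using CG by (rule order_trans)
    qed
  qed
  then show ?thesis by blast
qed

text \<open>Absolute integrability is tested with \<open>x\<close> inside:
  \<open>F_kernel_bound\<close> leaves a multiple of q^k f times \<open>\<bar>h\<bar>\<close>,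
  integrable by \<open>int\<close>. The excluded \<open>y = z\<close> is a null set.\<close>

lemma F_kernel_Fubini:
  assumes mom: "integrable lborel (\<lambda>t. \<bar>t\<bar> ^ (2 * Suc m - 1) * f t)" and z: "z \<in> S"
    and h[measurable]: "h \<in> borel_measurable borel" and h0: "\<And>y. y \<notin> S \<Longrightarrow> h y = 0"
    and int: "integrable lborel (\<lambda>y. F (Suc m) 0 y * h y)"
  shows "integrable lborel (\<lambda>x. F (Suc m) (Suc m) x * (\<integral>y. taylor_kernel m z x y * h y \<partial>lborel))"
    and "(\<integral>x. F (Suc m) (Suc m) x * (\<integral>y. taylor_kernel m z x y * h y \<partial>lborel) \<partial>lborel) =
      (-1) ^ Suc m * (\<integral>y. F (Suc m) 0 y * h y \<partial>lborel)"
proof -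
  let ?F = "F (Suc m) (Suc m)" and ?G = "F (Suc m) 0" and ?K = "taylor_kernel m z"
  define \<phi> where "\<phi> y x = (?F x * ?K x y) * h y" for y x
  have K_meas[measurable]: "(\<lambda>(y, x). ?K x y) \<in> borel_measurable (borel \<Otimes>\<^sub>M borel)"
    unfolding taylor_kernel_def by measurable
  have \<phi>_meas[measurable]: "case_prod \<phi> \<in> borel_measurable (lborel \<Otimes>\<^sub>M lborel)"
    unfolding \<phi>_def by measurable
  obtain C where C: "\<And>y. y \<in> S \<Longrightarrow> y \<noteq> z \<Longrightarrow> (\<integral>x. \<bar>?F x * ?K x y\<bar> \<partial>lborel) \<le> C * ?G y"
    using F_kernel_bound[OF mom z] by blast
  have ne: "AE y in lborel. y \<noteq> z" by (rule AE_lborel_singleton)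
  have \<phi>_int: "integrable lborel (\<phi> y)" if "y \<noteq> z" for y
  proof (cases "y \<in> S")
    case True
    then show ?thesis
      using F_kernel_integral(1)[OF mom True z that] by (simp add: \<phi>_def[abs_def])
  next
    case False
    then show ?thesis by (simp add: \<phi>_def[abs_def] h0)
  qed
  have prod_int: "integrable (lborel \<Otimes>\<^sub>M lborel) (case_prod \<phi>)"
  proof (rule lborel_pair.Fubini_integrable)
    show "integrable lborel (\<lambda>y. \<integral>x. norm (case_prod \<phi> (y, x)) \<partial>lborel)"
    proof (rule Bochner_Integration.integrable_bound)
      show "integrable lborel (\<lambda>y. C * (?G y * h y))" using int by simp
      show "(\<lambda>y. \<integral>x. norm (case_prod \<phi> (y, x)) \<partial>lborel) \<in> borel_measurable lborel" by measurable
      show "AE y in lborel. norm (\<integral>x. norm (case_prod \<phi> (y, x)) \<partial>lborel) \<le> norm (C * (?G y * h y))"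
        using ne
      proof eventually_elim
        case (elim y)
        have "(\<integral>x. \<bar>\<phi> y x\<bar> \<partial>lborel) = (\<integral>x. \<bar>?F x * ?K x y\<bar> \<partial>lborel) * \<bar>h y\<bar>"
          by (simp add: \<phi>_def abs_mult[of "_ * _" "h y"])
        also have "\<dots> \<le> \<bar>C * (?G y * h y)\<bar>"
        proof (cases "y \<in> S")
          case True
          have "(\<integral>x. \<bar>?F x * ?K x y\<bar> \<partial>lborel) * \<bar>h y\<bar> \<le> (C * ?G y) * \<bar>h y\<bar>"
            by (intro mult_right_mono C True elim) simp
          also have "\<dots> \<le> \<bar>C * ?G y\<bar> * \<bar>h y\<bar>" by (intro mult_right_mono) auto
          finally show ?thesis by (simp add: abs_mult mult.assoc)
        qed (simp add: h0)
        finally show ?case by simp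
      qed
    qed
    show "AE y in lborel. integrable lborel (\<lambda>x. case_prod \<phi> (y, x))"
      using ne by eventually_elim (simp add: \<phi>_int)
  qed (rule \<phi>_meas)
  have inner: "(\<integral>y. \<phi> y x \<partial>lborel) = ?F x * (\<integral>y. ?K x y * h y \<partial>lborel)" for x
    by (simp add: \<phi>_def mult.assoc)
  show "integrable lborel (\<lambda>x. ?F x * (\<integral>y. ?K x y * h y \<partial>lborel))"
    using lborel_pair.integrable_snd[OF prod_int] by (simp add: inner)
  have "(\<integral>x. ?F x * (\<integral>y. ?K x y * h y \<partial>lborel) \<partial>lborel) = (\<integral>y. (\<integral>x. \<phi> y x \<partial>lborel) \<partial>lborel)"
    using lborel_pair.Fubini_integral[OF prod_int] by (simp add: inner)
  also have "\<dots> = (\<integral>y. (-1) ^ Suc m * (?G y * h y) \<partial>lborel)"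
  proof (rule integral_cong_AE)
    show "AE y in lborel. (\<integral>x. \<phi> y x \<partial>lborel) = (-1) ^ Suc m * (?G y * h y)"
      using ne
    proof eventually_elim
      case (elim y)
      show ?case
      proof (cases "y \<in> S")
        case True
        then show ?thesis using F_kernel_integral(2)[OF mom True z elim] by (simp add: \<phi>_def)
      qed (simp add: \<phi>_def h0)
    qed
  qed measurable
  also have "\<dots> = (-1) ^ Suc m * (\<integral>y. ?G y * h y \<partial>lborel)" by (rule integral_mult_right_zero)
  finally show "(\<integral>x. ?F x * (\<integral>y. ?K x y * h y \<partial>lborel) \<partial>lborel) = (-1) ^ Suc m * (\<integral>y. ?G y * h y \<partial>lborel)" .
qed

text \<open>On a compact subinterval of the support \<open>F (Suc m) 0\<close> is bounded away from
  0, so the weighted hypothesis makes \<open>h\<close> Lebesgue integrable there. Only then does the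
  gauge integral of the Taylor formula equal the Lebesgue integral with the kernel.\<close>

lemma Taylor_remainder_kernel:
  assumes der: "has_kth_derivative (Suc m) g h r s" and z: "z \<in> S" and x: "x \<in> S"
    and int: "integrable lborel (\<lambda>y. F (Suc m) 0 y * (indicator S y * h y))"
  shows "(\<integral>y. taylor_kernel m z x y * (indicator S y * h y) \<partial>lborel) =
    g x - (\<Sum>i\<le>m. (deriv ^^ i) g z * ((x - z) ^ i / fact i))"
proof -
  let ?p = "\<lambda>y. (x - y) ^ m / fact m"
  let ?G = "F (Suc m) 0"
  \<comment> \<open>Here \<open>y\<close> is the expansion point: \<open>\<Psi> x\<close> is
    \<open>g x\<close> and \<open>\<Psi> z\<close> the Taylor polynomial about
    \<open>z\<close>.\<close>
  define \<Psi> where "\<Psi> y = (\<Sum>i\<le>m. (deriv ^^ i) g y * ((x - y) ^ i / fact i))" for y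
  have hm[measurable]: "(\<lambda>y. indicator S y * h y) \<in> borel_measurable borel"
    using der by (simp add: has_kth_derivative_def borel_measurable_restrict_space_iff)
  have "\<Psi> x = g x"
    using Taylor_sum_diag[of "\<lambda>i. (deriv ^^ i) g x" x m] by (simp add: \<Psi>_def)
  have I: "(LBINT y:{c<..<d}. h y * ?p y) = \<Psi> d - \<Psi> c" if cd: "c \<le> d" "c \<in> S" "d \<in> S" for c d
  proof -
    have sub: "{c..d} \<subseteq> S" by (rule Icc_subset_S[OF cd(2,3)])
    have "continuous_on {c..d} (\<lambda>y. ?p y / ?G y)"
      using sub F_0_pos by (intro continuous_intros F_continuous_on) (auto simp: less_le subset_iff)
    then obtain A where A: "A \<ge> 0" "\<And>y. y \<in> {c..d} \<Longrightarrow> \<bar>?p y / ?G y\<bar> \<le> A" by (rule bounded_on_Icc) (rule that)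
    have "integrable lborel (\<lambda>y. indicator {c<..<d} y *\<^sub>R (h y * ?p y))"
    proof (rule Bochner_Integration.integrable_bound)
      show "integrable lborel (\<lambda>y. A * (?G y * (indicator S y * h y)))" using int by simp
      have "(\<lambda>y. indicator {c<..<d} y *\<^sub>R (h y * ?p y)) = (\<lambda>y. indicator {c<..<d} y * ((indicator S y * h y) * ?p y))"
        using sub by (auto split: split_indicator simp: subset_iff)
      then show "(\<lambda>y. indicator {c<..<d} y *\<^sub>R (h y * ?p y)) \<in> borel_measurable lborel" by simp
      have "\<bar>h y * ?p y\<bar> \<le> \<bar>A * (?G y * h y)\<bar>" if "y \<in> {c..d}" for y
      proof -
        have pos: "?G y > 0" using F_0_pos sub that by blast
        have "\<bar>h y * ?p y\<bar> = \<bar>?p y / ?G y\<bar> * \<bar>?G y * h y\<bar>" using pos by (simp add: abs_mult)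
        also have "\<dots> \<le> A * \<bar>?G y * h y\<bar>" by (intro mult_right_mono A(2) that) simp
        finally show ?thesis using A(1) by (simp add: abs_mult)
      qed
      then show "AE y in lborel. norm (indicator {c<..<d} y *\<^sub>R (h y * ?p y)) \<le> norm (A * (?G y * (indicator S y * h y)))"
        using sub by (intro AE_I2) (auto split: split_indicator simp: subset_iff)
    qed
    then have "(LBINT y:{c<..<d}. h y * ?p y) = integral {c<..<d} (\<lambda>y. h y * ?p y)"
      by (intro set_borel_integral_eq_integral(2)) (simp add: set_integrable_def)
    also have "\<dots> = \<Psi> d - \<Psi> c"
      using has_kth_derivative_Taylor_integral[OF der cd(1) sub, of x]
      by (intro integral_unique) (simp add: \<Psi>_def has_integral_Icc_iff_Ioo)
    finally show ?thesis .
  qed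
  consider "z \<le> x" | "x < z" by linarith
  then show ?thesis
  proof cases
    case 1
    have "{z<..<x} \<subseteq> S" using Icc_subset_S[OF z x] by auto
    then have "(\<integral>y. taylor_kernel m z x y * (indicator S y * h y) \<partial>lborel) = (LBINT y:{z<..<x}. h y * ?p y)"
      unfolding set_lebesgue_integral_def using 1
      by (intro Bochner_Integration.integral_cong refl) (auto simp: taylor_kernel_def split: split_indicator)
    with I[OF 1 z x] \<open>\<Psi> x = g x\<close> show ?thesis by (simp add: \<Psi>_def)
  next
    case 2
    have "{x<..<z} \<subseteq> S" using Icc_subset_S[OF x z] by auto
    then have "(\<integral>y. taylor_kernel m z x y * (indicator S y * h y) \<partial>lborel) = (\<integral>y. - (indicator {x<..<z} y *\<^sub>R (h y * ?p y)) \<partial>lborel)"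
      using 2 by (intro Bochner_Integration.integral_cong refl) (auto simp: taylor_kernel_def split: split_indicator)
    also have "\<dots> = - (LBINT y:{x<..<z}. h y * ?p y)"
      unfolding set_lebesgue_integral_def by (rule integral_minus)
    finally show ?thesis using I[OF less_imp_le[OF 2] x z] \<open>\<Psi> x = g x\<close> by (simp add: \<Psi>_def)
  qed
qed

theorem rodrigues_integration_by_parts:
  assumes mom: "integrable lborel (\<lambda>t. \<bar>t\<bar> ^ (2 * Suc m - 1) * f t)" and z: "z \<in> S"
    and der: "has_kth_derivative (Suc m) g h r s"
    and int: "integrable lborel (\<lambda>y. F (Suc m) 0 y * (indicator S y * h y))"
  shows "integrable lborel (\<lambda>x. F (Suc m) (Suc m) x * g x)"
    and "(\<integral>x. F (Suc m) (Suc m) x * g x \<partial>lborel) =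
      (-1) ^ Suc m * (\<integral>y. F (Suc m) 0 y * (indicator S y * h y) \<partial>lborel)"
proof -
  let ?F = "F (Suc m) (Suc m)"
  let ?R = "\<lambda>x. \<integral>y. taylor_kernel m z x y * (indicator S y * h y) \<partial>lborel"
  let ?c = "\<lambda>i. (deriv ^^ i) g z * (-1) ^ i"
  have hm: "(\<lambda>y. indicator S y * h y) \<in> borel_measurable borel"
    using der by (simp add: has_kth_derivative_def borel_measurable_restrict_space_iff)
  note R = F_kernel_Fubini[OF mom z hm _ int, simplified]
  \<comment> \<open>The powers are reflected to \<open>z - x\<close>, the form with centre
    \<open>z\<close> in which \<open>F_power_integrals\<close> annihilates them.\<close>
  have eq: "?F x * g x = ?F x * ?R x + (\<Sum>i\<le>m. ?c i * (?F x * ((z - x) ^ i / fact i)))" for x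
  proof (cases "x \<in> S")
    case True
    have "(x - z) ^ i = (-1) ^ i * (z - x) ^ i" for i by (simp flip: power_mult_distrib)
    then have "g x = ?R x + (\<Sum>i\<le>m. ?c i * ((z - x) ^ i / fact i))"
      using Taylor_remainder_kernel[OF der z True int] by (simp add: mult.assoc)
    then show ?thesis by (simp add: algebra_simps sum_distrib_left)
  qed (simp add: F_zero)
  have P: "integrable lborel (\<lambda>x. ?c i * (?F x * ((z - x) ^ i / fact i)))"
    "(\<integral>x. ?c i * (?F x * ((z - x) ^ i / fact i)) \<partial>lborel) = 0" if "i \<le> m" for i
    using F_power_integrable[OF mom, of i z] F_power_integrals(3)[OF mom _ z, of i z] that
    by (simp_all del: times_divide_eq_right)
  have S_int: "integrable lborel (\<lambda>x. \<Sum>i\<le>m. ?c i * (?F x * ((z - x) ^ i / fact i)))"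
    by (intro Bochner_Integration.integrable_sum P) simp
  have "(\<integral>x. (\<Sum>i\<le>m. ?c i * (?F x * ((z - x) ^ i / fact i))) \<partial>lborel) =
      (\<Sum>i\<le>m. \<integral>x. ?c i * (?F x * ((z - x) ^ i / fact i)) \<partial>lborel)"
    by (intro Bochner_Integration.integral_sum P) simp
  also have "\<dots> = 0" by (intro sum.neutral ballI P(2)) simp
  finally have S0: "(\<integral>x. (\<Sum>i\<le>m. ?c i * (?F x * ((z - x) ^ i / fact i))) \<partial>lborel) = 0" .
  show "integrable lborel (\<lambda>x. ?F x * g x)"
    unfolding eq by (intro Bochner_Integration.integrable_add R(1) S_int)
  have "(\<integral>x. ?F x * g x \<partial>lborel) = (\<integral>x. ?F x * ?R x \<partial>lborel) + 0"
    unfolding eq S0[symmetric] by (intro Bochner_Integration.integral_add R(1) S_int)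
  then show "(\<integral>x. ?F x * g x \<partial>lborel) =
      (-1) ^ Suc m * (\<integral>y. F (Suc m) 0 y * (indicator S y * h y) \<partial>lborel)"
    using R(2) by simp
qed

end

section \<open>Transfer from the density to the random variable\<close>

theorem theorem3p1:
  fixes M :: "'a measure" and X :: "'a \<Rightarrow> real" and f q :: "real \<Rightarrow> real"
    and \<mu> \<delta> \<beta> \<gamma> :: real and r s :: ereal and k :: nat
  assumes prob: "prob_space M"
    and dens: "distributed M lborel X (\<lambda>x. ennreal (f x))"
    and f_nonneg: "\<And>x. f x \<ge> 0"
    and finite_mean: "integrable M X"
    and mean: "\<mu> = prob_space.expectation M X"
    and q: "\<And>x. q x = \<delta> * x\<^sup>2 + \<beta> * x + \<gamma>"
    and pearson: "\<And>x. (LBINT t:{..x}. (\<mu> - t) * f t) = q x * f x"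
    and support: "einterval r s = {x. f x > 0}"
  shows
    "(k \<ge> 1 \<and> integrable M (\<lambda>\<omega>. \<bar>X \<omega>\<bar> ^ (2 * k - 1)) \<longrightarrow>
       (\<forall>x\<in>einterval r s.
          interval_lebesgue_integrable lborel r (ereal x)
            (\<lambda>y. (x - y) ^ (k - 1) * rodrigues q f k y * f y) \<and>
          q x ^ k * f x = (-1) ^ k / fact (k - 1) *
            (LBINT y=r..ereal x. (x - y) ^ (k - 1) * rodrigues q f k y * f y) \<and>
          interval_lebesgue_integrable lborel (ereal x) s
            (\<lambda>y. (y - x) ^ (k - 1) * rodrigues q f k y * f y) \<and>
          q x ^ k * f x = 1 / fact (k - 1) *
            (LBINT y=ereal x..s. (y - x) ^ (k - 1) * rodrigues q f k y * f y)))
     \<and>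
     (integrable M (\<lambda>\<omega>. \<bar>X \<omega>\<bar> ^ (2 * k)) \<longrightarrow>
       (\<forall>g h. has_kth_derivative k g h r s \<and>
          set_integrable M {\<omega>\<in>space M. X \<omega> \<in> einterval r s} (\<lambda>\<omega>. q (X \<omega>) ^ k * \<bar>h (X \<omega>)\<bar>) \<longrightarrow>
          set_integrable M {\<omega>\<in>space M. X \<omega> \<in> einterval r s}
            (\<lambda>\<omega>. \<bar>rodrigues q f k (X \<omega>) * g (X \<omega>)\<bar>) \<and>
          (LINT \<omega>:{\<omega>\<in>space M. X \<omega> \<in> einterval r s}|M. rodrigues q f k (X \<omega>) * g (X \<omega>)) =
          (LINT \<omega>:{\<omega>\<in>space M. X \<omega> \<in> einterval r s}|M. q (X \<omega>) ^ k * h (X \<omega>))))"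
proof -
  interpret prob_space M by (rule prob)
  define Q where "Q = [:\<gamma>, \<beta>, \<delta>:]"
  have q_eq: "q = poly Q" by (rule ext) (simp add: q Q_def power2_eq_square algebra_simps)
  have moment: "integrable lborel (\<lambda>x. f x * u x) \<longleftrightarrow> integrable M (\<lambda>\<omega>. u (X \<omega>))"
    "(\<integral>x. f x * u x \<partial>lborel) = expectation (\<lambda>\<omega>. u (X \<omega>))"
    if "u \<in> borel_measurable borel" for u :: "real \<Rightarrow> real"
    using distributed_integrable[OF dens, of u] distributed_integral[OF dens, of u] that f_nonneg by auto
  have fm: "f \<in> borel_measurable borel"
    using distributed_real_measurable[OF _ dens] f_nonneg by simp
  have f_int: "integrable lborel f" and f_one: "(\<integral>x. f x \<partial>lborel) = 1"
    using moment[of "\<lambda>_. 1"] by (simp_all add: prob_space)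
  have tf_int: "integrable lborel (\<lambda>x. x * f x)" and tf_mean: "(\<integral>x. x * f x \<partial>lborel) = \<mu>"
    using moment[of "\<lambda>x. x"] finite_mean mean by (simp_all add: mult.commute)
  interpret pearson_density f Q \<mu> r s
  proof
    have "(\<integral>t. (\<mu> - t) * f t \<partial>lborel) = (\<integral>t. \<mu> * f t - t * f t \<partial>lborel)"
      by (simp add: algebra_simps)
    also have "\<dots> = \<mu> * (\<integral>t. f t \<partial>lborel) - (\<integral>t. t * f t \<partial>lborel)"
      using f_int tf_int by (subst Bochner_Integration.integral_diff) auto
    finally show "(\<integral>t. (\<mu> - t) * f t \<partial>lborel) = 0" by (simp add: f_one tf_mean)
    show "degree Q \<le> 2" by (simp add: Q_def)
    show "(LBINT t:{..x}. (\<mu> - t) * f t) = poly Q x * f x" for x using pearson q_eq by simp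
  qed (use fm f_nonneg f_int tf_int support in auto)
  have mom: "integrable lborel (\<lambda>t. \<bar>t\<bar> ^ n * f t)" if "integrable M (\<lambda>\<omega>. \<bar>X \<omega>\<bar> ^ n)" for n
    using moment(1)[of "\<lambda>t. \<bar>t\<bar> ^ n"] that by (simp add: mult.commute)
  show ?thesis
  proof (intro conjI impI allI ballI; (elim conjE)?)
    assume "1 \<le> k" and int: "integrable M (\<lambda>\<omega>. \<bar>X \<omega>\<bar> ^ (2 * k - 1))"
    then obtain m where k: "k = Suc m" by (cases k) auto
    fix x assume x: "x \<in> einterval r s"
    note rep = rodrigues_integral_representation[OF mom[OF int[unfolded k]] x]
    show "interval_lebesgue_integrable lborel r (ereal x) (\<lambda>y. (x - y) ^ (k - 1) * rodrigues q f k y * f y)"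
      using rep(1) by (simp add: k q_eq)
    show "q x ^ k * f x = (-1) ^ k / fact (k - 1) *
        (LBINT y=r..ereal x. (x - y) ^ (k - 1) * rodrigues q f k y * f y)"
      using rep(2) by (simp add: k q_eq)
    show "interval_lebesgue_integrable lborel (ereal x) s (\<lambda>y. (y - x) ^ (k - 1) * rodrigues q f k y * f y)"
      using rep(3) by (simp add: k q_eq)
    show "q x ^ k * f x = 1 / fact (k - 1) *
        (LBINT y=ereal x..s. (y - x) ^ (k - 1) * rodrigues q f k y * f y)"
      using rep(4) by (simp add: k q_eq)
  next
    fix g h
    assume int: "integrable M (\<lambda>\<omega>. \<bar>X \<omega>\<bar> ^ (2 * k))" and der: "has_kth_derivative k g h r s"
      and qh: "set_integrable M {\<omega>\<in>space M. X \<omega> \<in> einterval r s} (\<lambda>\<omega>. q (X \<omega>) ^ k * \<bar>h (X \<omega>)\<bar>)"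
    let ?A = "{\<omega>\<in>space M. X \<omega> \<in> einterval r s}"
    let ?R = "rodrigues q f k"
    have "set_integrable M ?A (\<lambda>\<omega>. \<bar>?R (X \<omega>) * g (X \<omega>)\<bar>) \<and>
      (LINT \<omega>:?A|M. ?R (X \<omega>) * g (X \<omega>)) = (LINT \<omega>:?A|M. q (X \<omega>) ^ k * h (X \<omega>))"
    proof (cases "k = 0 \<or> S = {}")
      \<comment> \<open>Here both integrands agree on the event: for \<open>k = 0\<close>, P_0 is 1
        and \<open>h = g\<close>; for empty \<open>S\<close> there is nothing to compare. All other
        cases supply an expansion point \<open>z\<close>.\<close>
      case True
      have eq: "?R (X \<omega>) * g (X \<omega>) = q (X \<omega>) ^ k * h (X \<omega>)"
        "\<bar>?R (X \<omega>) * g (X \<omega>)\<bar> = q (X \<omega>) ^ k * \<bar>h (X \<omega>)\<bar>" if "\<omega> \<in> ?A" for \<omega>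
        using True that der f_pos[of "X \<omega>"] by (auto simp: rodrigues_def has_kth_derivative_def abs_mult)
      have "set_integrable M ?A (\<lambda>\<omega>. \<bar>?R (X \<omega>) * g (X \<omega>)\<bar>)"
        using qh by (subst set_integrable_cong[OF refl refl eq(2)]) auto
      moreover have "(LINT \<omega>:?A|M. ?R (X \<omega>) * g (X \<omega>)) = (LINT \<omega>:?A|M. q (X \<omega>) ^ k * h (X \<omega>))"
        unfolding set_lebesgue_integral_def
        by (intro Bochner_Integration.integral_cong refl) (use eq(1) in \<open>auto split: split_indicator\<close>)
      ultimately show ?thesis by blast
    next
      case False
      then obtain m z where k: "k = Suc m" and z: "z \<in> S" by (cases k) auto
      note der' = der[unfolded k]
      have mom': "integrable lborel (\<lambda>t. \<bar>t\<bar> ^ (2 * Suc m - 1) * f t)"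
        by (rule moment_mono[OF mom[OF int]]) (simp add: k)
      have hm[measurable]: "(\<lambda>y. indicator S y * h y) \<in> borel_measurable borel"
        using der by (simp add: has_kth_derivative_def borel_measurable_restrict_space_iff)
      have gm[measurable]: "(\<lambda>y. indicator S y * g y) \<in> borel_measurable borel"
        using borel_measurable_continuous_on_indicator[OF _ has_kth_derivative_continuous_on[OF der']] by simp
      \<comment> \<open>Measurability is read off from the polynomial form, not from iterated
        \<open>deriv\<close>.\<close>
      have Rg: "indicator S y * (?R y * g y) = (-1) ^ k * poly (rodp k k) y * (indicator S y * g y)" for y
        using rodrigues_eq[of y k] by (auto simp: q_eq split: split_indicator)
      have Rgm: "(\<lambda>y. indicator S y * (?R y * g y)) \<in> borel_measurable borel"
        unfolding Rg by measurable
      have qhm: "(\<lambda>y. indicator S y * (q y ^ k * h y)) \<in> borel_measurable borel"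
        "(\<lambda>y. indicator S y * (q y ^ k * \<bar>h y\<bar>)) \<in> borel_measurable borel"
      proof -
        have "(\<lambda>y. indicator S y * (q y ^ k * h y)) = (\<lambda>y. poly Q y ^ k * (indicator S y * h y))"
          "(\<lambda>y. indicator S y * (q y ^ k * \<bar>h y\<bar>)) = (\<lambda>y. poly Q y ^ k * \<bar>indicator S y * h y\<bar>)"
          by (auto simp: q_eq split: split_indicator)
        then show "(\<lambda>y. indicator S y * (q y ^ k * h y)) \<in> borel_measurable borel"
          "(\<lambda>y. indicator S y * (q y ^ k * \<bar>h y\<bar>)) \<in> borel_measurable borel" by simp_all
      qed
      have Rgm': "(\<lambda>y. indicator S y * \<bar>?R y * g y\<bar>) \<in> borel_measurable borel"
      proof -
        have "(\<lambda>y. indicator S y * \<bar>?R y * g y\<bar>) = (\<lambda>y. \<bar>indicator S y * (?R y * g y)\<bar>)"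
          by (auto split: split_indicator)
        then show ?thesis using borel_measurable_abs[OF Rgm] by simp
      qed
      note tr = set_integral_distributed[OF dens f_nonneg borel_einterval]
      have Fh: "f y * (indicator S y * (q y ^ k * h y)) = F k 0 y * (indicator S y * h y)"
        "f y * (indicator S y * (q y ^ k * \<bar>h y\<bar>)) = \<bar>F k 0 y * (indicator S y * h y)\<bar>" for y
        using Q_pos[of y] f_nonneg[of y] by (auto simp: F_def q_eq abs_mult split: split_indicator)
      have Fg: "f y * (indicator S y * (?R y * g y)) = (-1) ^ k * (F k k y * g y)"
        "f y * (indicator S y * \<bar>?R y * g y\<bar>) = \<bar>F k k y * g y\<bar>" for y
        using rodrigues_eq[of y k] f_nonneg[of y]
        by (auto simp: F_def q_eq f_zero abs_mult power_abs split: split_indicator)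
      have "integrable lborel (\<lambda>y. \<bar>F k 0 y * (indicator S y * h y)\<bar>)"
        using qh unfolding tr(1)[OF qhm(2)] Fh .
      then have "integrable lborel (\<lambda>y. F k 0 y * (indicator S y * h y))"
        by (subst (asm) integrable_abs_iff) measurable
      note ibp = rodrigues_integration_by_parts[OF mom' z der' this[unfolded k], folded k]
      have "set_integrable M ?A (\<lambda>\<omega>. \<bar>?R (X \<omega>) * g (X \<omega>)\<bar>)"
        unfolding tr(1)[OF Rgm'] Fg by (rule integrable_abs[OF ibp(1)])
      moreover have "(LINT \<omega>:?A|M. ?R (X \<omega>) * g (X \<omega>)) = (LINT \<omega>:?A|M. q (X \<omega>) ^ k * h (X \<omega>))"
        unfolding tr(2)[OF Rgm] tr(2)[OF qhm(1)] Fg Fh integral_mult_right_zero ibp(2)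
        by (simp flip: mult.assoc power_mult_distrib)
      ultimately show ?thesis by blast
    qed
    then show "set_integrable M ?A (\<lambda>\<omega>. \<bar>?R (X \<omega>) * g (X \<omega>)\<bar>)"
      and "(LINT \<omega>:?A|M. ?R (X \<omega>) * g (X \<omega>)) = (LINT \<omega>:?A|M. q (X \<omega>) ^ k * h (X \<omega>))"
      by auto
  qed
qed

end
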